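(* Suppose $(A\xrightarrow{\psi_n}F_n\xrightarrow{\varphi_n}A)_n$ is a summable system of c.p.c. approximations of a separable nuclear $C^*$-algebra $A$. The associated c.p.c. system $(F_n,\psi_{n+1}\circ\varphi_n)_n$ is asymptotically multiplicative if and only if the sequence $(\psi_n)_n$ is approximately multiplicative in the sense that $\lim_n\|\psi_n(ab)-\psi_n(a)\psi_n(b)\|=0$ for all $a,b\in A$.
   Context: A map is c.p.c. if it is completely positive and contractive. A system of c.p.c. approximations $(A\xrightarrow{\psi_n}F_n\xrightarrow{\varphi_n}A)_n$ of a separable $C^*$-algebra $A$ consists of finite-dimensional $C^*$-algebras $F_n$ ($n\ge 0$) and c.p.c. maps $\psi_n\colon A\to F_n$, $\varphi_n\colon F_n\to A$ with $\lim_n\|\varphi_n(\psi_n(a))-a\|=0$ for all $a\in A$. It is summable if there is a decreasing sequence $(\varepsilon_m)_m$ of non-negative reals with $\sum_m\varepsilon_m\le 1$ such that $\|\varphi_n-\varphi_m\circ\psi_m\circ\varphi_n\|<\varepsilon_m$ for all $m>n\ge0$. Its associated c.p.c. system is $(F_n,\rho_{n+1,n})_n$ with $\rho_{n+1,n}=\psi_{n+1}\circ\varphi_n\colon F_n\to F_{n+1}$; for $m>n$ set $\rho_{m,n}=\rho_{m,m-1}\circ\cdots\circ\rho_{n+1,n}$ and $\rho_{n,n}=\mathrm{id}_{F_n}$. The system $(F_n,\rho_{n+1,n})_n$ is asymptotically multiplicative if for any $k\ge0$, $x,y\in F_k$ and $\varepsilon>0$ there is $M>k$ such that for all $m>n>M$,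 $$\|\rho_{m,n}(\rho_{n,k}(x)\rho_{n,k}(y))-\rho_{m,k}(x)\rho_{m,k}(y)\|<\varepsilon .$$ *)

theory Defs
  imports "HOL-Analysis.Analysis" "Jordan_Normal_Form.Matrix"
begin

text \<open>
  A C*-algebra is represented by its carrier, a complete *-subalgebra of an ambient type of class
  \<open>pre_cstar_algebra\<close> (complex normed *-algebras satisfying the C*-identity; neither a unit nor
  completeness is required of the ambient type, so C*-algebras need not be unital). A sequence of
  C*-algebras is a sequence of carriers in one ambient type. This is no restriction: any sequence
  of C*-algebras embeds isometrically and *-homomorphically into its \<open>c\<^sub>0\<close>-direct sum.
\<close>

class pre_cstar_algebra = real_normed_algebra +
  fixes scaleC :: "complex \<Rightarrow> 'a \<Rightarrow> 'a"
    and adj :: "'a \<Rightarrow> 'a"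
  assumes scaleR_scaleC: "scaleR r x = scaleC (complex_of_real r) x"
    and scaleC_add_right: "scaleC c (x + y) = scaleC c x + scaleC c y"
    and scaleC_add_left: "scaleC (c + d) x = scaleC c x + scaleC d x"
    and scaleC_scaleC: "scaleC c (scaleC d x) = scaleC (c * d) x"
    and scaleC_one: "scaleC 1 x = x"
    and mult_scaleC_left: "scaleC c x * y = scaleC c (x * y)"
    and mult_scaleC_right: "x * scaleC c y = scaleC c (x * y)"
    and norm_scaleC: "norm (scaleC c x) = cmod c * norm x"
    and adj_adj: "adj (adj x) = x"
    and adj_add: "adj (x + y) = adj x + adj y"
    and adj_scaleC: "adj (scaleC c x) = scaleC (cnj c) (adj x)"
    and adj_mult: "adj (x * y) = adj y * adj x"
    and cstar_identity: "norm (adj x * x) = (norm x)\<^sup>2"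

global_interpretation complex_space:
  Modules.module "scaleC :: complex \<Rightarrow> 'a \<Rightarrow> 'a::pre_cstar_algebra"
  defines csubspace = complex_space.subspace
    and cspan = complex_space.span
  by unfold_locales (simp_all add: scaleC_add_right scaleC_add_left scaleC_scaleC scaleC_one)

definition cstar_algebra :: "'a::pre_cstar_algebra set \<Rightarrow> bool" where
  "cstar_algebra S \<longleftrightarrow>
     csubspace S \<and> (\<forall>x\<in>S. \<forall>y\<in>S. x * y \<in> S) \<and> (\<forall>x\<in>S. adj x \<in> S) \<and> complete S"

definition finite_dimensional :: "'a::pre_cstar_algebra set \<Rightarrow> bool" where
  "finite_dimensional S \<longleftrightarrow> (\<exists>B. finite B \<and> S = cspan B)"

definition separable :: "'a::pre_cstar_algebra set \<Rightarrow> bool" where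
  "separable S \<longleftrightarrow> separable_space (top_of_set S)"


subsection \<open>Completely positive contractive maps\<close>

definition adj_mat :: "'a::pre_cstar_algebra mat \<Rightarrow> 'a mat" where
  "adj_mat Y = map_mat adj (transpose_mat Y)"

text \<open>Positivity in the C*-algebra \<open>M\<^sub>n(S)\<close>, in the form \<open>X = Y\<^sup>*Y\<close> with \<open>Y\<close> in \<open>M\<^sub>n(S)\<close>.\<close>

definition positive_mat :: "'a::pre_cstar_algebra set \<Rightarrow> nat \<Rightarrow> 'a mat \<Rightarrow> bool" where
  "positive_mat S n X \<longleftrightarrow>
     (\<exists>Y \<in> carrier_mat n n. elements_mat Y \<subseteq> S \<and> X = adj_mat Y * Y)"

definition clinear_map ::
    "'a::pre_cstar_algebra set \<Rightarrow> 'b::pre_cstar_algebra set \<Rightarrow> ('a \<Rightarrow> 'b) \<Rightarrow> bool" where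
  "clinear_map S T f \<longleftrightarrow>
     f ` S \<subseteq> T \<and>
     (\<forall>x\<in>S. \<forall>y\<in>S. f (x + y) = f x + f y) \<and>
     (\<forall>c. \<forall>x\<in>S. f (scaleC c x) = scaleC c (f x))"

definition completely_positive ::
    "'a::pre_cstar_algebra set \<Rightarrow> 'b::pre_cstar_algebra set \<Rightarrow> ('a \<Rightarrow> 'b) \<Rightarrow> bool" where
  "completely_positive S T f \<longleftrightarrow>
     clinear_map S T f \<and> (\<forall>n X. positive_mat S n X \<longrightarrow> positive_mat T n (map_mat f X))"

definition cpc_map ::
    "'a::pre_cstar_algebra set \<Rightarrow> 'b::pre_cstar_algebra set \<Rightarrow> ('a \<Rightarrow> 'b) \<Rightarrow> bool" where
  "cpc_map S T f \<longleftrightarrow> completely_positive S T f \<and> (\<forall>x\<in>S. norm (f x) \<le> norm x)"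


subsection \<open>Complex matrices of all sizes\<close>

text \<open>
  Infinite complex matrices with finitely many non-zero entries, with the operator norm on
  \<open>\<ell>\<^sup>2\<close>. They contain each \<open>M\<^sub>k(\<complex>)\<close> as a corner, with its usual operator norm.
\<close>

typedef fin_matrix =
  "{f :: nat \<Rightarrow> nat \<Rightarrow> complex. \<exists>k. \<forall>i j. f i j \<noteq> 0 \<longrightarrow> i < k \<and> j < k}"
  morphisms entry Fin_matrix
  by (rule exI[of _ "\<lambda>_ _. 0"]) simp

setup_lifting type_definition_fin_matrix

definition supp_in :: "nat \<Rightarrow> (nat \<Rightarrow> nat \<Rightarrow> complex) \<Rightarrow> bool" where
  "supp_in k f \<longleftrightarrow> (\<forall>i j. f i j \<noteq> 0 \<longrightarrow> i < k \<and> j < k)"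

definition mprod ::
    "(nat \<Rightarrow> nat \<Rightarrow> complex) \<Rightarrow> (nat \<Rightarrow> nat \<Rightarrow> complex) \<Rightarrow> nat \<Rightarrow> nat \<Rightarrow> complex" where
  "mprod f g i j = (\<Sum>l | f i l \<noteq> 0. f i l * g l j)"

definition mapply :: "(nat \<Rightarrow> nat \<Rightarrow> complex) \<Rightarrow> (nat \<Rightarrow> complex) \<Rightarrow> nat \<Rightarrow> complex" where
  "mapply f v i = (\<Sum>l | f i l \<noteq> 0. f i l * v l)"

definition ell2_unit_ball :: "(nat \<Rightarrow> complex) set" where
  "ell2_unit_ball = {v. \<forall>J. finite J \<longrightarrow> L2_set (\<lambda>j. cmod (v j)) J \<le> 1}"

definition mopnorm :: "(nat \<Rightarrow> nat \<Rightarrow> complex) \<Rightarrow> real" where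
  "mopnorm f =
     (SUP v\<in>ell2_unit_ball. L2_set (\<lambda>i. cmod (mapply f v i)) {i. \<exists>j. f i j \<noteq> 0})"

lemma supp_in_entry: "\<exists>k. supp_in k (entry X)"
  using entry[of X] by (simp add: supp_in_def)

lemma supp_in_mono: "supp_in k f \<Longrightarrow> k \<le> l \<Longrightarrow> supp_in l f"
  unfolding supp_in_def by (meson less_le_trans)

lemma supp_in_entry2: "\<exists>k. supp_in k (entry X) \<and> supp_in k (entry Y)"
  by (metis supp_in_entry supp_in_mono nat_le_linear)

lemma mprod_eq: "supp_in k f \<Longrightarrow> mprod f g i j = (\<Sum>l<k. f i l * g l j)"
  unfolding mprod_def supp_in_def by (rule sum.mono_neutral_left) auto

lemma mapply_eq: "supp_in k f \<Longrightarrow> mapply f v i = (\<Sum>l<k. f i l * v l)"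
  unfolding mapply_def supp_in_def by (rule sum.mono_neutral_left) auto

lemma supp_in_mprod:
  assumes "supp_in k f" "supp_in k g"
  shows "supp_in k (mprod f g)"
proof -
  have "mprod f g i j = 0" if "\<not> (i < k \<and> j < k)" for i j
    unfolding mprod_eq[OF assms(1)]
  proof (rule sum.neutral, rule ballI)
    fix l
    show "f i l * g l j = 0"
      using that assms unfolding supp_in_def by (metis mult_eq_0_iff)
  qed
  then show ?thesis unfolding supp_in_def by blast
qed

abbreviation vnorm :: "nat \<Rightarrow> (nat \<Rightarrow> complex) \<Rightarrow> real" where
  "vnorm k v \<equiv> L2_set (\<lambda>i. cmod (v i)) {..<k}"

lemma mapply_L2:
  assumes "supp_in k f"
  shows "L2_set (\<lambda>i. cmod (mapply f v i)) {i. \<exists>j. f i j \<noteq> 0} = vnorm k (mapply f v)"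
  unfolding L2_set_def
proof (rule arg_cong[where f = sqrt], rule sum.mono_neutral_left)
  show "{i. \<exists>j. f i j \<noteq> 0} \<subseteq> {..<k}" using assms by (auto simp: supp_in_def)
qed (auto simp: mapply_def)

lemma mopnorm_eq:
  "supp_in k f \<Longrightarrow> mopnorm f = (SUP v\<in>ell2_unit_ball. vnorm k (mapply f v))"
  unfolding mopnorm_def by (simp add: mapply_L2)

lemma vnorm_cut: "vnorm k (\<lambda>i. if i < k then v i else 0) = vnorm k v"
  by (rule L2_set_cong) auto

lemma cut_in_ball:
  assumes "vnorm k v \<le> 1"
  shows "(\<lambda>i. if i < k then v i else 0) \<in> ell2_unit_ball"
  unfolding ell2_unit_ball_def
proof safe
  fix J :: "nat set" assume J: "finite J"
  have "L2_set (\<lambda>j. cmod (if j < k then v j else 0)) J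
      = L2_set (\<lambda>j. cmod (v j)) (J \<inter> {..<k})"
    unfolding L2_set_def
    by (rule arg_cong[where f = sqrt], rule sum.mono_neutral_cong_right) (use J in auto)
  also have "\<dots> \<le> vnorm k v"
    unfolding L2_set_def by (rule real_sqrt_le_mono, rule sum_mono2) auto
  finally show "L2_set (\<lambda>j. cmod (if j < k then v j else 0)) J \<le> 1" using assms by simp
qed

lemma mopnorm_bdd:
  assumes "supp_in k f"
  shows "bdd_above ((\<lambda>v. vnorm k (mapply f v)) ` ell2_unit_ball)"
proof (rule bdd_aboveI2)
  fix v assume v: "v \<in> ell2_unit_ball"
  have v1: "cmod (v j) \<le> 1" for j
    using v[unfolded ell2_unit_ball_def, simplified, rule_format, of "{j}"] by simp
  have "vnorm k (mapply f v) \<le> (\<Sum>i<k. cmod (mapply f v i))"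
    by (rule L2_set_le_sum) simp
  also have "\<dots> \<le> (\<Sum>i<k. \<Sum>j<k. cmod (f i j))"
    unfolding mapply_eq[OF assms]
    by (intro sum_mono order_trans[OF norm_sum]) (simp add: norm_mult mult_left_le v1)
  finally show "vnorm k (mapply f v) \<le> (\<Sum>i<k. \<Sum>j<k. cmod (f i j))" .
qed

lemma mapply_scale: "mapply f (\<lambda>i. c * v i) = (\<lambda>i. c * mapply f v i)"
  unfolding mapply_def by (simp add: sum_distrib_left mult.left_commute)

lemma vnorm_scale: "vnorm k (\<lambda>i. c * v i) = cmod c * vnorm k v"
  by (simp add: norm_mult L2_set_right_distrib)

lemma mapply_cut:
  "supp_in k f \<Longrightarrow> mapply f (\<lambda>i. if i < k then v i else 0) = mapply f v"
  by (rule ext) (simp add: mapply_eq)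

lemma mopnorm_nonneg: "supp_in k f \<Longrightarrow> 0 \<le> mopnorm f"
proof -
  assume f: "supp_in k f"
  have "(\<lambda>_. 0) \<in> ell2_unit_ball" by (simp add: ell2_unit_ball_def L2_set_def)
  from cSUP_upper[OF this mopnorm_bdd[OF f]] show ?thesis
    by (simp add: mopnorm_eq[OF f]) (meson L2_set_nonneg order_trans)
qed

lemma mopnorm_bound:
  assumes f: "supp_in k f"
  shows "vnorm k (mapply f v) \<le> mopnorm f * vnorm k v"
proof (cases "vnorm k v = 0")
  case True
  then have "v l = 0" if "l < k" for l
    using that by (simp add: L2_set_eq_0_iff)
  then have "mapply f v = (\<lambda>_. 0)" by (intro ext) (simp add: mapply_eq[OF f])
  then show ?thesis using True by (simp add: L2_set_def)
next
  case False
  define r where "r = vnorm k v"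
  have r: "r > 0" using False by (simp add: r_def less_le)
  define w where "w = (\<lambda>i. complex_of_real (inverse r) * v i)"
  have "vnorm k w = 1"
    unfolding w_def vnorm_scale r_def[symmetric] using r by (simp add: norm_inverse)
  then have "vnorm k (mapply f (\<lambda>i. if i < k then w i else 0)) \<le> mopnorm f"
    unfolding mopnorm_eq[OF f]
    by (intro cSUP_upper mopnorm_bdd[OF f] cut_in_ball) simp
  then have "inverse r * vnorm k (mapply f v) \<le> mopnorm f"
    unfolding mapply_cut[OF f] w_def mapply_scale vnorm_scale using r
    by (simp add: norm_inverse)
  then show ?thesis using r by (simp add: r_def[symmetric] field_simps)
qed

lemma mopnorm_least:
  assumes f: "supp_in k f" and c: "c \<ge> 0" and le: "\<And>v. vnorm k (mapply f v) \<le> c * vnorm k v"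
  shows "mopnorm f \<le> c"
  unfolding mopnorm_eq[OF f]
proof (rule cSUP_least)
  show "ell2_unit_ball \<noteq> {}"
    using cut_in_ball[where k = 0 and v = "\<lambda>_. 0"] by auto
  fix v assume "v \<in> ell2_unit_ball"
  then have "vnorm k v \<le> 1" by (simp add: ell2_unit_ball_def)
  then show "vnorm k (mapply f v) \<le> c"
    using le[of v] mult_left_le[OF _ c, of "vnorm k v"] by linarith
qed

lemma vnorm_triangle: "vnorm k (\<lambda>i. u i + v i) \<le> vnorm k u + vnorm k v"
proof -
  have "vnorm k (\<lambda>i. u i + v i) \<le> L2_set (\<lambda>i. cmod (u i) + cmod (v i)) {..<k}"
    by (rule L2_set_mono) (auto intro: norm_triangle_ineq)
  also have "\<dots> \<le> vnorm k u + vnorm k v" by (rule L2_set_triangle_ineq)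
  finally show ?thesis .
qed

lemma mapply_mprod:
  assumes "supp_in k f" "supp_in k g"
  shows "mapply (mprod f g) v = mapply f (mapply g v)"
proof
  fix i
  have "mapply (mprod f g) v i = (\<Sum>l<k. \<Sum>m<k. f i m * g m l * v l)"
    by (simp add: mapply_eq[OF supp_in_mprod[OF assms]] mprod_eq[OF assms(1)] sum_distrib_right)
  also have "\<dots> = (\<Sum>m<k. \<Sum>l<k. f i m * g m l * v l)" by (rule sum.swap)
  also have "\<dots> = mapply f (mapply g v) i"
    by (simp add: mapply_eq[OF assms(1)] mapply_eq[OF assms(2)] sum_distrib_left mult.assoc)
  finally show "mapply (mprod f g) v i = mapply f (mapply g v) i" .
qed

definition mstar :: "(nat \<Rightarrow> nat \<Rightarrow> complex) \<Rightarrow> nat \<Rightarrow> nat \<Rightarrow> complex" where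
  "mstar f i j = cnj (f j i)"

lemma supp_in_mstar: "supp_in k f \<Longrightarrow> supp_in k (mstar f)"
  by (auto simp: supp_in_def mstar_def)

lemma mopnorm_mprod:
  assumes "supp_in k f" "supp_in k g"
  shows "mopnorm (mprod f g) \<le> mopnorm f * mopnorm g"
proof (rule mopnorm_least[OF supp_in_mprod[OF assms]])
  note nn = mopnorm_nonneg[OF assms(1)] mopnorm_nonneg[OF assms(2)]
  then show "0 \<le> mopnorm f * mopnorm g" by simp
  fix v
  have "vnorm k (mapply f (mapply g v)) \<le> mopnorm f * vnorm k (mapply g v)"
    by (rule mopnorm_bound[OF assms(1)])
  also have "\<dots> \<le> mopnorm f * (mopnorm g * vnorm k v)"
    by (rule mult_left_mono[OF mopnorm_bound[OF assms(2)] nn(1)])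
  finally show "vnorm k (mapply (mprod f g) v) \<le> mopnorm f * mopnorm g * vnorm k v"
    by (simp add: mapply_mprod[OF assms])
qed

lemma mopnorm_sq_le:
  assumes f: "supp_in k f"
  shows "(mopnorm f)\<^sup>2 \<le> mopnorm (mprod (mstar f) f)"
proof -
  note g = supp_in_mstar[OF f]
  note p = supp_in_mprod[OF g f]
  let ?P = "mprod (mstar f) f"
  have key: "(vnorm k (mapply f v))\<^sup>2 \<le> mopnorm ?P * (vnorm k v)\<^sup>2" for v
  proof -
    have "complex_of_real ((vnorm k (mapply f v))\<^sup>2)
        = (\<Sum>i<k. mapply f v i * cnj (mapply f v i))"
      by (simp only: L2_set_def) (simp add: sum_nonneg complex_norm_square[symmetric])
    also have "\<dots> = (\<Sum>i<k. \<Sum>l<k. mapply f v i * (cnj (f i l) * cnj (v l)))"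
      by (subst (2) mapply_eq[OF f]) (simp add: sum_distrib_left)
    also have "\<dots> = (\<Sum>l<k. \<Sum>i<k. mapply f v i * (cnj (f i l) * cnj (v l)))"
      by (rule sum.swap)
    also have "\<dots> = (\<Sum>l<k. mapply (mstar f) (mapply f v) l * cnj (v l))"
      unfolding mapply_eq[OF g] mstar_def sum_distrib_right
      by (intro sum.cong refl) (simp add: mult_ac)
    finally have "(vnorm k (mapply f v))\<^sup>2 = cmod (\<Sum>l<k. mapply ?P v l * cnj (v l))"
      by (simp only: mapply_mprod[OF g f]) (metis norm_of_real abs_power2)
    also have "\<dots> \<le> (\<Sum>l<k. \<bar>cmod (mapply ?P v l)\<bar> * \<bar>cmod (v l)\<bar>)"
      by (rule order_trans[OF norm_sum]) (simp add: norm_mult)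
    also have "\<dots> \<le> vnorm k (mapply ?P v) * vnorm k v" by (rule L2_set_mult_ineq)
    also have "\<dots> \<le> mopnorm ?P * vnorm k v * vnorm k v"
      by (rule mult_right_mono[OF mopnorm_bound[OF p]]) simp
    finally show ?thesis by (simp add: power2_eq_square mult.assoc)
  qed
  have "mopnorm f \<le> sqrt (mopnorm ?P)"
  proof (rule mopnorm_least[OF f])
    show "0 \<le> sqrt (mopnorm ?P)" using mopnorm_nonneg[OF p] by simp
    fix v
    have "sqrt ((vnorm k (mapply f v))\<^sup>2) \<le> sqrt (mopnorm ?P * (vnorm k v)\<^sup>2)"
      by (rule real_sqrt_le_mono[OF key])
    then show "vnorm k (mapply f v) \<le> sqrt (mopnorm ?P) * vnorm k v"
      by (simp add: real_sqrt_mult)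
  qed
  then have "(mopnorm f)\<^sup>2 \<le> (sqrt (mopnorm ?P))\<^sup>2"
    by (rule power_mono[OF _ mopnorm_nonneg[OF f]])
  then show ?thesis using mopnorm_nonneg[OF p] by simp
qed

lemma mstar_mstar: "mstar (mstar f) = f"
  by (intro ext) (simp add: mstar_def)

lemma mopnorm_le_mstar:
  assumes f: "supp_in k f"
  shows "mopnorm f \<le> mopnorm (mstar f)"
proof (cases "mopnorm f = 0")
  case True
  then show ?thesis using mopnorm_nonneg[OF supp_in_mstar[OF f]] by simp
next
  case False
  then have "mopnorm f > 0" using mopnorm_nonneg[OF f] by simp
  moreover have "mopnorm f * mopnorm f \<le> mopnorm (mstar f) * mopnorm f"
    using mopnorm_sq_le[OF f] mopnorm_mprod[OF supp_in_mstar[OF f] f]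
    by (simp add: power2_eq_square)
  ultimately show ?thesis by simp
qed

lemma mopnorm_cstar:
  assumes f: "supp_in k f"
  shows "mopnorm (mprod (mstar f) f) = (mopnorm f)\<^sup>2"
proof (rule antisym[OF _ mopnorm_sq_le[OF f]])
  note g = supp_in_mstar[OF f]
  have "mopnorm (mstar f) \<le> mopnorm f" using mopnorm_le_mstar[OF g] by (simp add: mstar_mstar)
  then have "mopnorm (mstar f) * mopnorm f \<le> mopnorm f * mopnorm f"
    by (rule mult_right_mono[OF _ mopnorm_nonneg[OF f]])
  then show "mopnorm (mprod (mstar f) f) \<le> (mopnorm f)\<^sup>2"
    using mopnorm_mprod[OF g f] by (simp add: power2_eq_square)
qed

lemma mopnorm_scale_le:
  assumes f: "supp_in k f"
  shows "mopnorm (\<lambda>i j. c * f i j) \<le> cmod c * mopnorm f"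
proof -
  have s: "supp_in k (\<lambda>i j. c * f i j)" using f by (auto simp: supp_in_def)
  have e: "mapply (\<lambda>i j. c * f i j) v = (\<lambda>i. c * mapply f v i)" for v
    by (intro ext) (simp add: mapply_eq[OF s] mapply_eq[OF f] sum_distrib_left mult.assoc)
  show ?thesis
  proof (rule mopnorm_least[OF s])
    show "0 \<le> cmod c * mopnorm f" using mopnorm_nonneg[OF f] by simp
    fix v show "vnorm k (mapply (\<lambda>i j. c * f i j) v) \<le> cmod c * mopnorm f * vnorm k v"
      unfolding e vnorm_scale using mult_left_mono[OF mopnorm_bound[OF f] norm_ge_zero]
      by (simp add: mult.assoc)
  qed
qed

lemma mopnorm_scale:
  assumes f: "supp_in k f"
  shows "mopnorm (\<lambda>i j. c * f i j) = cmod c * mopnorm f"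
proof (rule antisym[OF mopnorm_scale_le[OF f]])
  have s: "supp_in k (\<lambda>i j. c * f i j)" using f by (auto simp: supp_in_def)
  show "cmod c * mopnorm f \<le> mopnorm (\<lambda>i j. c * f i j)"
  proof (cases "c = 0")
    case True
    then show ?thesis using mopnorm_nonneg[OF s] by simp
  next
    case False
    then have "(\<lambda>i j. inverse c * (c * f i j)) = f" by (simp add: mult.assoc[symmetric])
    then have "mopnorm f \<le> cmod (inverse c) * mopnorm (\<lambda>i j. c * f i j)"
      using mopnorm_scale_le[OF s, of "inverse c"] by simp
    then have "cmod c * mopnorm f
        \<le> cmod c * (cmod (inverse c) * mopnorm (\<lambda>i j. c * f i j))"
      by (rule mult_left_mono) simp
    then show ?thesis using False by (simp add: norm_inverse mult.assoc[symmetric])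
  qed
qed

lemma mopnorm_triangle:
  assumes f: "supp_in k f" and g: "supp_in k g"
  shows "mopnorm (\<lambda>i j. f i j + g i j) \<le> mopnorm f + mopnorm g"
proof -
  have s: "supp_in k (\<lambda>i j. f i j + g i j)"
    using f g unfolding supp_in_def by (metis add.right_neutral)
  have e: "mapply (\<lambda>i j. f i j + g i j) v = (\<lambda>i. mapply f v i + mapply g v i)" for v
    by (intro ext)
      (simp add: mapply_eq[OF s] mapply_eq[OF f] mapply_eq[OF g] sum.distrib distrib_right)
  show ?thesis
  proof (rule mopnorm_least[OF s])
    show "0 \<le> mopnorm f + mopnorm g" using mopnorm_nonneg[OF f] mopnorm_nonneg[OF g] by simp
    fix v
    show "vnorm k (mapply (\<lambda>i j. f i j + g i j) v) \<le> (mopnorm f + mopnorm g) * vnorm k v"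
      unfolding e distrib_right
      using vnorm_triangle[of "mapply f v" "mapply g v" k]
        mopnorm_bound[OF f, of v] mopnorm_bound[OF g, of v]
      by linarith
  qed
qed

lemma mopnorm_eq_0:
  assumes f: "supp_in k f" and "mopnorm f = 0"
  shows "f = (\<lambda>_ _. 0)"
proof (intro ext)
  fix i j
  show "f i j = 0"
  proof (cases "i < k \<and> j < k")
    case False
    then show ?thesis using f by (auto simp: supp_in_def)
  next
    case True
    let ?e = "\<lambda>l. if l = j then 1 else 0 :: complex"
    have "vnorm k (mapply f ?e) \<le> 0" using mopnorm_bound[OF f, of ?e] assms(2) by simp
    then have "vnorm k (mapply f ?e) = 0" by (simp add: antisym)
    then have "mapply f ?e i = 0" using True by (simp add: L2_set_eq_0_iff)
    then show ?thesis using True by (simp add: mapply_eq[OF f] if_distrib cong: if_cong)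
  qed
qed

lemma mopnorm_zero: "mopnorm (\<lambda>_ _. 0) = 0"
  using mopnorm_scale[of 0 "\<lambda>_ _. 0" 0] by (simp add: supp_in_def)

instantiation fin_matrix :: pre_cstar_algebra
begin

lift_definition zero_fin_matrix :: fin_matrix is "\<lambda>_ _. 0" by simp

lift_definition plus_fin_matrix :: "fin_matrix \<Rightarrow> fin_matrix \<Rightarrow> fin_matrix"
  is "\<lambda>f g i j. f i j + g i j"
proof -
  fix f g :: "nat \<Rightarrow> nat \<Rightarrow> complex"
  assume "\<exists>k. \<forall>i j. f i j \<noteq> 0 \<longrightarrow> i < k \<and> j < k" "\<exists>k. \<forall>i j. g i j \<noteq> 0 \<longrightarrow> i < k \<and> j < k"
  then obtain k l where "supp_in k f" "supp_in l g" by (auto simp: supp_in_def)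
  then have "supp_in (max k l) f" "supp_in (max k l) g" by (auto elim: supp_in_mono)
  then show "\<exists>k. \<forall>i j. f i j + g i j \<noteq> 0 \<longrightarrow> i < k \<and> j < k"
    unfolding supp_in_def by (metis add.right_neutral)
qed

lift_definition scaleC_fin_matrix :: "complex \<Rightarrow> fin_matrix \<Rightarrow> fin_matrix"
  is "\<lambda>c f i j. c * f i j" by auto

lift_definition times_fin_matrix :: "fin_matrix \<Rightarrow> fin_matrix \<Rightarrow> fin_matrix" is mprod
proof -
  fix f g :: "nat \<Rightarrow> nat \<Rightarrow> complex"
  assume "\<exists>k. \<forall>i j. f i j \<noteq> 0 \<longrightarrow> i < k \<and> j < k" "\<exists>k. \<forall>i j. g i j \<noteq> 0 \<longrightarrow> i < k \<and> j < k"
  then obtain k l where "supp_in k f" "supp_in l g" by (auto simp: supp_in_def)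
  then have "supp_in (max k l) f" "supp_in (max k l) g" by (auto elim: supp_in_mono)
  then show "\<exists>k. \<forall>i j. mprod f g i j \<noteq> 0 \<longrightarrow> i < k \<and> j < k"
    using supp_in_mprod[of "max k l" f g] unfolding supp_in_def by blast
qed

lift_definition adj_fin_matrix :: "fin_matrix \<Rightarrow> fin_matrix" is mstar
  by (auto simp: mstar_def)

lift_definition norm_fin_matrix :: "fin_matrix \<Rightarrow> real" is mopnorm .

definition uminus_fin_matrix :: "fin_matrix \<Rightarrow> fin_matrix" where
  "uminus_fin_matrix X = scaleC (- 1) X"

definition minus_fin_matrix :: "fin_matrix \<Rightarrow> fin_matrix \<Rightarrow> fin_matrix" where
  "minus_fin_matrix X Y = X + - Y"

definition scaleR_fin_matrix :: "real \<Rightarrow> fin_matrix \<Rightarrow> fin_matrix" where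
  "scaleR_fin_matrix r X = scaleC (complex_of_real r) X"

definition dist_fin_matrix :: "fin_matrix \<Rightarrow> fin_matrix \<Rightarrow> real" where
  "dist_fin_matrix X Y = norm (X - Y)"

definition sgn_fin_matrix :: "fin_matrix \<Rightarrow> fin_matrix" where
  "sgn_fin_matrix X = inverse (norm X) *\<^sub>R X"

definition uniformity_fin_matrix :: "(fin_matrix \<times> fin_matrix) filter" where
  "uniformity_fin_matrix = (INF e\<in>{0<..}. principal {(X, Y). dist X Y < e})"

definition open_fin_matrix :: "fin_matrix set \<Rightarrow> bool" where
  "open_fin_matrix U = (\<forall>X\<in>U. eventually (\<lambda>(X', Y). X' = X \<longrightarrow> Y \<in> U) uniformity)"

instance
proof
  fix X Y Z :: fin_matrix and r s :: real and c d :: complex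
  obtain k where k: "supp_in k (entry X)" "supp_in k (entry Y)" "supp_in k (entry Z)"
    using supp_in_entry[of Z] supp_in_entry2[of X Y] by (metis supp_in_mono nat_le_linear)
  note ent = zero_fin_matrix.rep_eq plus_fin_matrix.rep_eq scaleC_fin_matrix.rep_eq
    times_fin_matrix.rep_eq adj_fin_matrix.rep_eq norm_fin_matrix.rep_eq
  note me = mprod_eq[OF k(1)] mprod_eq[OF k(2)]
  show add_assoc: "X + Y + Z = X + (Y + Z)" by transfer (simp add: add.assoc)
  show "X + Y = Y + X" by transfer (simp add: add.commute)
  show "0 + X = X" by transfer simp
  show "- X + X = 0" unfolding uminus_fin_matrix_def by transfer simp
  show "X - Y = X + - Y" by (simp add: minus_fin_matrix_def)
  show "r *\<^sub>R (X + Y) = r *\<^sub>R X + r *\<^sub>R Y"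
    unfolding scaleR_fin_matrix_def by transfer (simp add: distrib_left)
  show "(r + s) *\<^sub>R X = r *\<^sub>R X + s *\<^sub>R X"
    unfolding scaleR_fin_matrix_def by transfer (simp add: distrib_right)
  show "r *\<^sub>R s *\<^sub>R X = (r * s) *\<^sub>R X"
    unfolding scaleR_fin_matrix_def by transfer (simp add: mult.assoc)
  show "1 *\<^sub>R X = X" unfolding scaleR_fin_matrix_def by transfer simp
  show "scaleR r X = scaleC (complex_of_real r) X" by (simp add: scaleR_fin_matrix_def)
  show "scaleC c (X + Y) = scaleC c X + scaleC c Y" by transfer (simp add: distrib_left)
  show "scaleC (c + d) X = scaleC c X + scaleC d X" by transfer (simp add: distrib_right)
  show "scaleC c (scaleC d X) = scaleC (c * d) X" by transfer (simp add: mult.assoc)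
  show "scaleC 1 X = X" by transfer simp
  show "X * Y * Z = X * (Y * Z)"
  proof (rule entry_inject[THEN iffD1], intro ext)
    fix i j
    have "entry (X * Y * Z) i j = (\<Sum>l<k. \<Sum>m<k. entry X i m * entry Y m l * entry Z l j)"
      by (simp add: ent mprod_eq[OF supp_in_mprod[OF k(1,2)]] mprod_eq[OF k(1)] sum_distrib_right)
    also have "\<dots> = (\<Sum>m<k. \<Sum>l<k. entry X i m * entry Y m l * entry Z l j)" by (rule sum.swap)
    also have "\<dots> = entry (X * (Y * Z)) i j" by (simp add: ent me sum_distrib_left mult.assoc)
    finally show "entry (X * Y * Z) i j = entry (X * (Y * Z)) i j" .
  qed
  have sXY: "supp_in k (entry (X + Y))"
    using k unfolding supp_in_def ent by (metis add.right_neutral)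
  show "(X + Y) * Z = X * Z + Y * Z"
    by (rule entry_inject[THEN iffD1], intro ext)
      (simp add: ent mprod_eq[OF sXY[unfolded ent]] me distrib_right sum.distrib)
  show "X * (Y + Z) = X * Y + X * Z"
    by (rule entry_inject[THEN iffD1], intro ext) (simp add: ent me distrib_left sum.distrib)
  have scX: "supp_in k (\<lambda>i j. c * entry X i j)" for c using k(1) by (auto simp: supp_in_def)
  show sl: "scaleC c X * Y = scaleC c (X * Y)" for c
    by (rule entry_inject[THEN iffD1], intro ext)
      (simp add: ent mprod_eq[OF scX] me sum_distrib_left mult.assoc)
  show sr: "X * scaleC c Y = scaleC c (X * Y)" for c
    by (rule entry_inject[THEN iffD1], intro ext)
      (simp add: ent me sum_distrib_left mult.left_commute)
  show "r *\<^sub>R X * Y = r *\<^sub>R (X * Y)" "X * r *\<^sub>R Y = r *\<^sub>R (X * Y)"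
    by (simp_all add: scaleR_fin_matrix_def sl sr)
  show "dist X Y = norm (X - Y)" by (simp add: dist_fin_matrix_def)
  show "sgn X = inverse (norm X) *\<^sub>R X" by (simp add: sgn_fin_matrix_def)
  show "(uniformity :: (fin_matrix \<times> fin_matrix) filter)
      = (INF e\<in>{0<..}. principal {(X, Y). dist X Y < e})"
    by (simp add: uniformity_fin_matrix_def)
  show "open U = (\<forall>X\<in>U. eventually (\<lambda>(X', Y). X' = X \<longrightarrow> Y \<in> U) uniformity)"
    for U :: "fin_matrix set"
    by (simp add: open_fin_matrix_def)
  show "(norm X = 0) = (X = 0)"
    using mopnorm_eq_0[OF k(1)] mopnorm_zero
    by (auto simp: ent entry_inject[symmetric])
  show "norm (X + Y) \<le> norm X + norm Y"
    unfolding ent by (rule mopnorm_triangle[OF k(1,2)])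
  show nc: "norm (scaleC c X) = cmod c * norm X" for c
    unfolding ent by (rule mopnorm_scale[OF k(1)])
  show "norm (r *\<^sub>R X) = \<bar>r\<bar> * norm X" by (simp add: scaleR_fin_matrix_def nc)
  show "norm (X * Y) \<le> norm X * norm Y"
    unfolding ent by (rule mopnorm_mprod[OF k(1,2)])
  show "adj (adj X) = X" by transfer (simp add: mstar_mstar)
  show "adj (X + Y) = adj X + adj Y" by transfer (simp add: mstar_def fun_eq_iff)
  show "adj (scaleC c X) = scaleC (cnj c) (adj X)" by transfer (simp add: mstar_def fun_eq_iff)
  show "adj (X * Y) = adj Y * adj X"
    by (rule entry_inject[THEN iffD1], intro ext)
      (simp add: ent mstar_def[of "mprod _ _"] me mprod_eq[OF supp_in_mstar[OF k(2)]],
       simp add: mstar_def mult.commute)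
  show "norm (adj X * X) = (norm X)\<^sup>2" unfolding ent by (rule mopnorm_cstar[OF k(1)])
qed

end

text \<open>The full matrix algebra \<open>M\<^sub>k(\<complex>)\<close>, as the upper left corner.\<close>

definition matrix_algebra :: "nat \<Rightarrow> fin_matrix set" where
  "matrix_algebra k = {X. \<forall>i j. entry X i j \<noteq> 0 \<longrightarrow> i < k \<and> j < k}"


subsection \<open>Nuclearity and systems of approximations\<close>

text \<open>
  Nuclearity as the completely positive approximation property: the identity map is a
  point-norm limit of c.p.c. maps factoring through full matrix algebras.
\<close>

definition nuclear :: "'a::pre_cstar_algebra set \<Rightarrow> bool" where
  "nuclear A \<longleftrightarrow>
     (\<forall>G \<epsilon>. finite G \<and> G \<subseteq> A \<and> \<epsilon> > 0 \<longrightarrow>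
        (\<exists>k \<psi> \<phi>. cpc_map A (matrix_algebra k) \<psi> \<and> cpc_map (matrix_algebra k) A \<phi> \<and>
           (\<forall>a\<in>G. norm (\<phi> (\<psi> a) - a) < \<epsilon>)))"

definition cpc_approximations ::
    "'a::pre_cstar_algebra set \<Rightarrow> (nat \<Rightarrow> 'f::pre_cstar_algebra set) \<Rightarrow>
     (nat \<Rightarrow> 'a \<Rightarrow> 'f) \<Rightarrow> (nat \<Rightarrow> 'f \<Rightarrow> 'a) \<Rightarrow> bool" where
  "cpc_approximations A F \<psi> \<phi> \<longleftrightarrow>
     (\<forall>n. cstar_algebra (F n) \<and> finite_dimensional (F n) \<and>
          cpc_map A (F n) (\<psi> n) \<and> cpc_map (F n) A (\<phi> n)) \<and>
     (\<forall>a\<in>A. (\<lambda>n. norm (\<phi> n (\<psi> n a) - a)) \<longlonglongrightarrow> 0)"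

text \<open>The operator norm of a (bounded) linear map on \<open>S\<close>.\<close>

definition opnorm_on :: "'a::pre_cstar_algebra set \<Rightarrow> ('a \<Rightarrow> 'b::pre_cstar_algebra) \<Rightarrow> real" where
  "opnorm_on S f = (SUP x \<in> {x \<in> S. norm x \<le> 1}. norm (f x))"

definition summable_approximations ::
    "(nat \<Rightarrow> 'f::pre_cstar_algebra set) \<Rightarrow>
     (nat \<Rightarrow> 'a::pre_cstar_algebra \<Rightarrow> 'f) \<Rightarrow> (nat \<Rightarrow> 'f \<Rightarrow> 'a) \<Rightarrow> bool" where
  "summable_approximations F \<psi> \<phi> \<longleftrightarrow>
     (\<exists>\<epsilon> :: nat \<Rightarrow> real. decseq \<epsilon> \<and> (\<forall>m. 0 \<le> \<epsilon> m) \<and> summable \<epsilon> \<and> (\<Sum>m. \<epsilon> m) \<le> 1 \<and>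
        (\<forall>n m. n < m \<longrightarrow> opnorm_on (F n) (\<lambda>x. \<phi> n x - \<phi> m (\<psi> m (\<phi> n x))) < \<epsilon> m))"

text \<open>
  \<open>connecting \<rho> m n\<close> is \<open>\<rho>\<^bsub>m,n\<^esub> = \<rho>\<^bsub>m,m-1\<^esub> \<circ> \<dots> \<circ> \<rho>\<^bsub>n+1,n\<^esub>\<close>, where \<open>\<rho> n\<close> is \<open>\<rho>\<^bsub>n+1,n\<^esub>\<close>;
  it is meant for \<open>n \<le> m\<close> (and is the identity for \<open>m \<le> n\<close>).
\<close>

primrec connecting :: "(nat \<Rightarrow> 'f \<Rightarrow> 'f) \<Rightarrow> nat \<Rightarrow> nat \<Rightarrow> 'f \<Rightarrow> 'f" where
  "connecting \<rho> 0 n = id"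
| "connecting \<rho> (Suc m) n = (if n \<le> m then \<rho> m \<circ> connecting \<rho> m n else id)"

definition asymptotically_multiplicative ::
    "(nat \<Rightarrow> 'f::pre_cstar_algebra set) \<Rightarrow> (nat \<Rightarrow> 'f \<Rightarrow> 'f) \<Rightarrow> bool" where
  "asymptotically_multiplicative F \<rho> \<longleftrightarrow>
     (\<forall>k. \<forall>x\<in>F k. \<forall>y\<in>F k. \<forall>\<epsilon>>0. \<exists>M>k. \<forall>n>M. \<forall>m>n.
        norm (connecting \<rho> m n (connecting \<rho> n k x * connecting \<rho> n k y)
              - connecting \<rho> m k x * connecting \<rho> m k y) < \<epsilon>)"

definition approximately_multiplicative ::
    "'a::pre_cstar_algebra set \<Rightarrow> (nat \<Rightarrow> 'a \<Rightarrow> 'f::pre_cstar_algebra) \<Rightarrow> bool" where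
  "approximately_multiplicative A \<psi> \<longleftrightarrow>
     (\<forall>a\<in>A. \<forall>b\<in>A. (\<lambda>n. norm (\<psi> n (a * b) - \<psi> n a * \<psi> n b)) \<longlonglongrightarrow> 0)"

end

theory Submission
  imports Defs
begin

text \<open>
  The algebraic core is that \<open>\<phi>\<^sub>n (\<psi>\<^sub>n(a) \<psi>\<^sub>n(b)) \<longlonglongrightarrow> ab\<close> for every system of c.p.c.
  approximations. By the Kadison-Schwarz inequality for \<open>\<phi>\<^sub>n\<close> and \<open>\<psi>\<^sub>n\<close>,
  \<open>\<phi>\<^sub>n(\<psi>\<^sub>n(a))\<^sup>* \<phi>\<^sub>n(\<psi>\<^sub>n(a)) \<le> \<phi>\<^sub>n(\<psi>\<^sub>n(a)\<^sup>* \<psi>\<^sub>n(a)) \<le> \<phi>\<^sub>n(\<psi>\<^sub>n(a\<^sup>* a))\<close>, and both ends converge to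
  \<open>a\<^sup>* a\<close>; polarization does the rest. By summability \<open>\<rho>\<^bsub>m,n\<^esub>\<close> is uniformly close to \<open>\<psi>\<^sub>m \<circ> \<phi>\<^sub>n\<close>
  for large \<open>n < m\<close>, so both conditions compare \<open>\<psi>\<^sub>m(ab)\<close> with \<open>\<psi>\<^sub>m(a) \<psi>\<^sub>m(b)\<close>.

  Order relations are tested on positive functionals, and nuclearity supplies enough of them,
  namely the vector states of the matrix algebras that approximately factor the identity. Hence
  neither spectral theory nor representations are needed: approximate units come from the fact
  that \<open>1 - T\<^sup>2\<close> is a contraction for each self-adjoint contraction \<open>T\<close>.
\<close>

section \<open>Self-adjoint operators\<close>

lemma adj_zero [simp]: "adj (0::'a::pre_cstar_algebra) = 0"
  using adj_add[of "0::'a" 0] by simp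

lemma adj_minus: "adj (- x) = - adj (x::'a::pre_cstar_algebra)"
  using adj_add[of x "- x"] by (simp add: eq_neg_iff_add_eq_0 add.commute)

lemma adj_diff: "adj (x - y) = adj x - adj (y::'a::pre_cstar_algebra)"
  using adj_add[of x "- y"] by (simp add: adj_minus)

lemma adj_scaleR: "adj (r *\<^sub>R x) = r *\<^sub>R adj (x::'a::pre_cstar_algebra)"
  by (simp add: scaleR_scaleC adj_scaleC)

lemma scaleC_diff_right: "scaleC c (x - y) = scaleC c x - scaleC c (y::'a::pre_cstar_algebra)"
  by (rule complex_space.scale_right_diff_distrib)

lemma norm_adj [simp]: "norm (adj x) = norm (x::'a::pre_cstar_algebra)"
proof -
  have le: "norm x \<le> norm (adj x)" for x :: 'a
  proof (cases "x = 0")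
    case False
    have "norm x * norm x \<le> norm (adj x) * norm x"
      using norm_mult_ineq[of "adj x" x] by (simp add: cstar_identity power2_eq_square)
    with False show ?thesis by simp
  qed simp
  from le[of x] le[of "adj x"] show ?thesis by (simp add: adj_adj)
qed

text \<open>Nondegeneracy of the algebra-valued inner product \<open>adj x * y\<close>, tested at
  \<open>x = u - v\<close>. It makes every operator that is symmetric for this inner product
  linear.\<close>

lemma adj_mult_left_cancel:
  fixes u v :: "'a::pre_cstar_algebra"
  assumes "\<And>x. adj x * u = adj x * v"
  shows "u = v"
proof -
  have "(norm (u - v))\<^sup>2 = norm (adj (u - v) * u - adj (u - v) * v)"
    by (simp add: cstar_identity[symmetric] right_diff_distrib)
  then show ?thesis by (simp add: assms)
qed

text \<open>Testing at \<open>y = adj w\<close> recovers the norm from left multiplication, so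
  operator bounds become norm bounds even without a unit.\<close>

lemma norm_le_if_mult_le:
  fixes w :: "'a::pre_cstar_algebra"
  assumes "\<And>y. norm (w * y) \<le> c * norm y" "0 \<le> c"
  shows "norm w \<le> c"
proof (cases "w = 0")
  case False
  have "norm w * norm w \<le> c * norm w"
    using assms(1)[of "adj w"] cstar_identity[of "adj w"] by (simp add: adj_adj power2_eq_square)
  with False show ?thesis by simp
qed (use assms in simp)

text \<open>Self-adjointness for the inner product \<open>adj x * y\<close>. Operators are used
  because 1 - T makes sense for them even when the algebra has no unit.\<close>

definition sym_op :: "('a::pre_cstar_algebra \<Rightarrow> 'a) \<Rightarrow> bool" where
  "sym_op T \<longleftrightarrow> (\<forall>x y. adj (T x) * y = adj x * T y)"

lemma sym_opD: "sym_op T \<Longrightarrow> adj (T x) * y = adj x * T y"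
  by (simp add: sym_op_def)

lemma sym_op_add:
  assumes "sym_op T" shows "T (x + y) = T x + T y"
  by (rule adj_mult_left_cancel) (simp add: sym_opD[OF assms, symmetric] distrib_left)

lemma sym_op_diff:
  assumes "sym_op T" shows "T (x - y) = T x - T y"
  by (rule adj_mult_left_cancel) (simp add: sym_opD[OF assms, symmetric] right_diff_distrib)

lemma sym_op_scaleR:
  assumes "sym_op T" shows "T (r *\<^sub>R y) = r *\<^sub>R T y"
  by (rule adj_mult_left_cancel) (simp add: sym_opD[OF assms, symmetric])

lemma norm_sym_op_sq: "sym_op T \<Longrightarrow> (norm (T x))\<^sup>2 = norm (adj x * T (T x))"
  by (simp add: cstar_identity[symmetric] sym_opD)

lemma sym_op_comp: "sym_op T \<Longrightarrow> sym_op (\<lambda>y. T (T y))"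
  by (simp add: sym_op_def)

lemma sym_op_one_minus: "sym_op T \<Longrightarrow> sym_op (\<lambda>y. y - T y)"
  by (simp add: sym_op_def adj_diff left_diff_distrib right_diff_distrib)

lemma sym_op_funpow: "sym_op T \<Longrightarrow> sym_op (T ^^ n)"
  by (induction n) (simp_all add: sym_op_def funpow_swap1)

text \<open>
  The iteration converges to \<open>W = 1 - \<surd>(1 - T\<^sup>2)\<close>, the solution of \<open>2 W = T\<^sup>2 + W\<^sup>2\<close>.
\<close>

primrec sqrt_iter :: "('a::pre_cstar_algebra \<Rightarrow> 'a) \<Rightarrow> nat \<Rightarrow> 'a \<Rightarrow> 'a" where
  "sqrt_iter T 0 y = 0"
| "sqrt_iter T (Suc n) y = (1/2) *\<^sub>R (T (T y) + sqrt_iter T n (sqrt_iter T n y))"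

lemma sym_op_sqrt_iter: "sym_op T \<Longrightarrow> sym_op (sqrt_iter T n)"
  by (induction n)
    (simp_all add: sym_op_def adj_scaleR adj_add distrib_left distrib_right)

lemma sqrt_iter_commute:
  assumes "sym_op T" shows "T (sqrt_iter T n y) = sqrt_iter T n (T y)"
  by (induction n arbitrary: y)
    (use sym_op_diff[OF assms, of 0 0] in \<open>simp_all add: sym_op_scaleR[OF assms] sym_op_add[OF assms]\<close>)

lemma norm_sqrt_iter_le:
  assumes "\<And>y. norm (T y) \<le> r * norm y" "0 \<le> r" "r < 1"
  shows "norm (sqrt_iter T n y) \<le> r * norm y"
proof (induction n arbitrary: y)
  case 0 show ?case using assms by simp
next
  case (Suc n)
  have 1: "norm (T (T y)) \<le> r * (r * norm y)"
    using assms(1)[of "T y"] mult_left_mono[OF assms(1)[of y] assms(2)] by linarith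
  have 2: "norm (sqrt_iter T n (sqrt_iter T n y)) \<le> r * (r * norm y)"
    using Suc[of "sqrt_iter T n y"] mult_left_mono[OF Suc[of y] assms(2)] by linarith
  have "r * (r * norm y) \<le> 1 * (r * norm y)"
    by (rule mult_right_mono) (use assms in auto)
  with 1 2 norm_triangle_ineq[of "T (T y)" "sqrt_iter T n (sqrt_iter T n y)"]
  show ?case by simp
qed

text \<open>For consecutive iterates, V^2 - W^2 = V (V - W) + (V - W) W. Each summand gains a factor
  \<open>r\<close>, and the 1/2 in the recursion makes up for there being two of them.\<close>

lemma sqrt_iter_diff_le:
  assumes T: "sym_op T" and r: "\<And>y. norm (T y) \<le> r * norm y" "0 \<le> r" "r < 1"
  shows "norm (sqrt_iter T (Suc n) y - sqrt_iter T n y) \<le> r ^ n * norm y"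
proof (induction n arbitrary: y)
  case 0
  show ?case
    using norm_sqrt_iter_le[OF r, of 1 y] mult_right_mono[of r 1 "norm y"] r by simp
next
  case (Suc n)
  let ?W = "sqrt_iter T n" and ?V = "sqrt_iter T (Suc n)"
  have "sqrt_iter T (Suc (Suc n)) y - ?V y = (1/2) *\<^sub>R (?V (?V y) - ?W (?W y))"
    by (simp add: sym_op_scaleR algebra_simps)
  also have "?V (?V y) - ?W (?W y) = ?V (?V y - ?W y) + (?V (?W y) - ?W (?W y))"
    by (simp add: sym_op_diff[OF sym_op_sqrt_iter[OF T]] del: sqrt_iter.simps)
  finally have "norm (sqrt_iter T (Suc (Suc n)) y - ?V y)
     \<le> (1/2) * (norm (?V (?V y - ?W y)) + norm (?V (?W y) - ?W (?W y)))"
    by (simp add: norm_triangle_ineq del: sqrt_iter.simps)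
  moreover have "norm (?V (?V y - ?W y)) \<le> r * (r ^ n * norm y)"
    using norm_sqrt_iter_le[OF r, of "Suc n" "?V y - ?W y"] mult_left_mono[OF Suc[of y] r(2)]
    by linarith
  moreover have "norm (?V (?W y) - ?W (?W y)) \<le> r ^ n * (r * norm y)"
    using Suc[of "?W y"]
      mult_left_mono[OF norm_sqrt_iter_le[OF r, of n y], of "r ^ n"] r(2) by (smt (verit) zero_le_power)
  ultimately show ?case by (simp add: mult_ac del: sqrt_iter.simps)
qed

text \<open>V = 1 - W is, up to a factor i, half the difference of T + iV and T - iV, hence nearly a
  contraction. So is V^2, which is 1 - T^2 up to \<open>2 *\<^sub>R D y\<close>. Finite iterates
  with errors of order \<open>r ^ n\<close> suffice, so no limit operator has to exist in a possibly
  incomplete type.\<close>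

lemma norm_one_minus_sq_le_aux:
  assumes T: "sym_op T" and r: "\<And>y. norm (T y) \<le> r * norm y" "0 \<le> r" "r < 1"
  shows "norm (y - T (T y)) \<le> norm y"
proof -
  have bound: "norm (y - T (T y)) \<le> (1 + 4 * r ^ n) * norm y" for n
  proof -
    define W where "W = sqrt_iter T n"
    define D where "D = (\<lambda>y. sqrt_iter T (Suc n) y - W y)"
    define V where "V = (\<lambda>y. y - W y)"
    have W: "sym_op W" using sym_op_sqrt_iter[OF T] by (simp add: W_def)
    have V: "sym_op V" unfolding V_def by (rule sym_op_one_minus[OF W])
    have D: "norm (D y) \<le> r ^ n * norm y" for y
      unfolding D_def W_def by (rule sqrt_iter_diff_le[OF T r])
    have comm: "T (V y) = V (T y)" for y
      by (simp add: V_def W_def sym_op_diff[OF T] sqrt_iter_commute[OF T])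
    \<comment> \<open>As V^2 = 1 - 2 W + W^2, this is the recursion for the next iterate,
      rearranged.\<close>
    have sq: "T (T y) + V (V y) = y + 2 *\<^sub>R D y" for y
      by (simp add: V_def D_def sym_op_diff[OF W]) (simp add: W_def algebra_simps scaleR_2)
    \<comment> \<open>Up to the error \<open>D\<close>, \<open>V = \<surd>(1 - T\<^sup>2)\<close>, so that \<open>T \<plusminus> i V\<close> is nearly unitary.\<close>
    have U: "(norm (T y + scaleC c (V y)))\<^sup>2 \<le> (1 + 2 * r ^ n) * (norm y)\<^sup>2"
      if c: "c = \<i> \<or> c = - \<i>" for c y
    proof -
      have "adj (T y + scaleC c (V y)) * (T y + scaleC c (V y))
          = adj y * T (T y) + scaleC (c + cnj c) (adj y * T (V y)) + scaleC (c * cnj c) (adj y * V (V y))"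
        by (simp add: adj_add adj_scaleC distrib_left distrib_right mult_scaleC_left
            scaleC_add_right mult_scaleC_right sym_opD[OF T] sym_opD[OF V] comm[symmetric] scaleC_scaleC scaleC_add_left
            mult.commute add_ac)
      \<comment> \<open>For these \<open>c\<close>, \<open>c + cnj c = 0\<close> removes the cross
        term and \<open>c * cnj c = 1\<close>.\<close>
      also have "\<dots> = adj y * (T (T y) + V (V y))"
        using c by (auto simp: scaleC_one distrib_left)
      finally have "(norm (T y + scaleC c (V y)))\<^sup>2 = norm (adj y * (y + 2 *\<^sub>R D y))"
        by (simp add: cstar_identity[symmetric] sq)
      also have "\<dots> \<le> norm y * (norm y + 2 * norm (D y))"
        by (rule order_trans[OF norm_mult_ineq])
          (auto intro!: mult_left_mono order_trans[OF norm_triangle_ineq])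
      also have "\<dots> \<le> norm y * (norm y + 2 * (r ^ n * norm y))"
        using D[of y] by (intro mult_left_mono) auto
      finally show ?thesis by (simp add: power2_eq_square algebra_simps)
    qed
    have Vy: "norm (V y) \<le> sqrt (1 + 2 * r ^ n) * norm y" for y
    proof -
      have le: "norm (T y + scaleC c (V y)) \<le> sqrt (1 + 2 * r ^ n) * norm y"
        if "c = \<i> \<or> c = - \<i>" for c
        using U[OF that, of y] by (metis norm_ge_zero real_le_rsqrt real_sqrt_mult real_sqrt_unique)
      have "(T y + scaleC \<i> (V y)) - (T y + scaleC (-\<i>) (V y)) = scaleC (2 * \<i>) (V y)"
        by (simp add: complex_space.scale_minus_left scaleC_add_left[symmetric])
      then have "2 * norm (V y) = norm ((T y + scaleC \<i> (V y)) - (T y + scaleC (-\<i>) (V y)))"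
        by (simp add: norm_scaleC norm_mult)
      also have "\<dots> \<le> 2 * (sqrt (1 + 2 * r ^ n) * norm y)"
        using le[of \<i>] le[of "-\<i>"] by (intro order_trans[OF norm_triangle_ineq4]) auto
      finally show ?thesis by simp
    qed
    have "norm (V (V y)) \<le> sqrt (1 + 2 * r ^ n) * (sqrt (1 + 2 * r ^ n) * norm y)"
      by (rule order_trans[OF Vy], rule mult_left_mono[OF Vy]) (use r in simp)
    also have "\<dots> = (1 + 2 * r ^ n) * norm y"
      using r by (simp add: mult.assoc[symmetric])
    finally have VV: "norm (V (V y)) \<le> (1 + 2 * r ^ n) * norm y" .
    have "y - T (T y) = V (V y) - 2 *\<^sub>R D y"
      using sq[of y] by (simp add: algebra_simps)
    then have "norm (y - T (T y)) \<le> norm (V (V y)) + 2 * norm (D y)"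
      using norm_triangle_ineq4[of "V (V y)" "2 *\<^sub>R D y"] by simp
    with VV D[of y] show ?thesis by (simp add: algebra_simps)
  qed
  have "(\<lambda>n. (1 + 4 * r ^ n) * norm y) \<longlonglongrightarrow> (1 + 4 * 0) * norm y"
    by (intro tendsto_intros LIMSEQ_power_zero) (use r in simp)
  from LIMSEQ_le_const[OF this] bound show ?thesis by simp
qed

text \<open>Scaling \<open>T\<close> by \<open>s < 1\<close> gives the strict bound of the auxiliary
  lemma; then \<open>s\<close> tends to 1.\<close>

lemma norm_one_minus_sq_le:
  assumes T: "sym_op T" and le: "\<And>y. norm (T y) \<le> norm y"
  shows "norm (y - T (T y)) \<le> norm y"
proof -
  have bound: "norm (y - (s * s) *\<^sub>R T (T y)) \<le> norm y" if s: "0 \<le> s" "s < 1" for s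
  proof -
    have "sym_op (\<lambda>y. s *\<^sub>R T y)"
      using T by (simp add: sym_op_def adj_scaleR)
    from norm_one_minus_sq_le_aux[OF this, of s y] show ?thesis
      using s le by (simp add: mult_left_mono sym_op_scaleR[OF T])
  qed
  define s where "s n = 1 - inverse (real (Suc n))" for n
  have s1: "s \<longlonglongrightarrow> 1 - 0"
    unfolding s_def by (intro tendsto_intros LIMSEQ_inverse_real_of_nat)
  have "(\<lambda>n. norm (y - (s n * s n) *\<^sub>R T (T y))) \<longlonglongrightarrow> norm (y - (1 * 1) *\<^sub>R T (T y))"
    using s1 by (intro tendsto_intros) auto
  moreover have "norm (y - (s n * s n) *\<^sub>R T (T y)) \<le> norm y" for n
    by (rule bound) (simp_all add: s_def field_simps)
  ultimately show ?thesis by (metis (no_types, lifting) LIMSEQ_le_const2 mult_1 scaleR_one)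
qed

lemma
  assumes "cstar_algebra S"
  shows cstar_algebra_zero: "0 \<in> S"
    and cstar_algebra_add: "\<And>x y. x \<in> S \<Longrightarrow> y \<in> S \<Longrightarrow> x + y \<in> S"
    and cstar_algebra_diff: "\<And>x y. x \<in> S \<Longrightarrow> y \<in> S \<Longrightarrow> x - y \<in> S"
    and cstar_algebra_scaleC: "\<And>c x. x \<in> S \<Longrightarrow> scaleC c x \<in> S"
    and cstar_algebra_scaleR: "\<And>r x. x \<in> S \<Longrightarrow> r *\<^sub>R x \<in> S"
    and cstar_algebra_mult: "\<And>x y. x \<in> S \<Longrightarrow> y \<in> S \<Longrightarrow> x * y \<in> S"
    and cstar_algebra_adj: "\<And>x. x \<in> S \<Longrightarrow> adj x \<in> S"
    and cstar_algebra_sum: "\<And>f I. (\<And>i. i \<in> I \<Longrightarrow> f i \<in> S) \<Longrightarrow> sum f I \<in> S"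
  using assms complex_space.subspace_sum[of S]
  by (auto simp: cstar_algebra_def scaleR_scaleC complex_space.subspace_0
      complex_space.subspace_add complex_space.subspace_diff complex_space.subspace_scale)

lemmas cstar_algebra_closed =
  cstar_algebra_zero cstar_algebra_add cstar_algebra_diff cstar_algebra_scaleC
  cstar_algebra_scaleR cstar_algebra_mult cstar_algebra_adj

section \<open>Approximate units\<close>

text \<open>
  With \<open>h = a a\<^sup>*\<close> and \<open>G = 1 - h\<^sup>2\<close>, the witness is the Cesaro mean of the elements \<open>1 - G\<^sup>2\<^sup>j\<close>.
  These are contractions because \<open>G\<^sup>j\<close> is, and averaging turns the telescoping sum of
  \<open>G\<^sup>2\<^sup>j (1 - G\<^sup>2)\<close> into decay.
\<close>

lemma approximate_unit_contraction:
  assumes S: "cstar_algebra S" and a: "a \<in> S" "norm a \<le> 1" and m: "m > 0"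
  shows "\<exists>e\<in>S. norm e \<le> 1 \<and> norm (adj e * a - a) \<le> sqrt (sqrt (2 / real m))"
proof -
  define h where "h = a * adj a"
  define H where "H = (\<lambda>y. h * y)"
  define G where "G = (\<lambda>y. y - H (H y))"
  have hS: "h \<in> S" using S a by (simp add: h_def cstar_algebra_closed)
  have adj_h: "adj h = h" by (simp add: h_def adj_mult adj_adj)
  have "norm h \<le> norm a * norm a" using norm_mult_ineq[of a "adj a"] by (simp add: h_def)
  also have "\<dots> \<le> 1" using a mult_le_one[of "norm a" "norm a"] by simp
  finally have nh: "norm h \<le> 1" .
  have sH: "sym_op H" by (simp add: sym_op_def H_def adj_mult adj_h mult.assoc)
  have nH: "norm (H y) \<le> norm y" for y
    using norm_mult_ineq[of h y] mult_right_mono[OF nh, of "norm y"] by (simp add: H_def)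
  have sG: "sym_op G"
    unfolding G_def by (rule sym_op_one_minus[OF sym_op_comp[OF sH]])
  have nG: "norm (G y) \<le> norm y" for y
    unfolding G_def by (rule norm_one_minus_sq_le[OF sH nH])
  have nGj: "norm ((G ^^ j) y) \<le> norm y" for j y
    by (induction j) (use nG order_trans in auto)
  have nGj': "norm (y - (G ^^ (2 * j)) y) \<le> norm y" for j y
    using norm_one_minus_sq_le[OF sym_op_funpow[OF sG, of j] nGj]
    by (simp add: mult_2 funpow_add)
  \<comment> \<open>1 - G^j is a polynomial in \<open>h\<close> without constant term, so it is left
    multiplication by an element of \<open>S\<close> although 1 need not lie in
    \<open>S\<close>.\<close>
  have "\<exists>g\<in>S. \<forall>y. y - (G ^^ j) y = g * y" for j
  proof (induction j)
    case 0 show ?case by (rule bexI[of _ 0]) (simp_all add: cstar_algebra_zero[OF S])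
  next
    case (Suc j)
    then obtain g where g: "g \<in> S" "\<And>y. (G ^^ j) y = y - g * y"
      by (metis add_diff_cancel_left' diff_add_cancel)
    have "y - (G ^^ Suc j) y = (g + h * h - h * h * g) * y" for y
      by (simp add: g) (simp add: G_def H_def algebra_simps)
    moreover have "g + h * h - h * h * g \<in> S"
      using g hS by (simp add: cstar_algebra_closed[OF S])
    ultimately show ?case by blast
  qed
  then obtain g where gS: "\<And>j. g j \<in> S" and g: "\<And>j y. y - (G ^^ j) y = g j * y"
    by metis
  define e where "e = (1 / real m) *\<^sub>R (\<Sum>j<m. g (2 * j))"
  define C where "C = (\<lambda>y. y - e * y)"
  have eS: "e \<in> S"
    by (simp add: e_def gS cstar_algebra_scaleR[OF S] cstar_algebra_sum[OF S])
  have ey: "e * y = (1 / real m) *\<^sub>R (\<Sum>j<m. y - (G ^^ (2 * j)) y)" for y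
    by (simp only: e_def g mult_scaleR_left sum_distrib_right)
  have avg: "norm ((1 / real m) *\<^sub>R (\<Sum>j<m. u j)) \<le> c" if "\<And>j. norm (u j) \<le> c" for u c
  proof -
    have "norm (\<Sum>j<m. u j) \<le> (\<Sum>j<m. c)" by (rule sum_norm_le) (rule that)
    then show ?thesis using m by (simp add: field_simps)
  qed
  have "norm (e * y) \<le> 1 * norm y" for y unfolding ey mult_1 by (rule avg) (rule nGj')
  then have ne: "norm e \<le> 1" by (rule norm_le_if_mult_le) simp
  have C: "C y = (1 / real m) *\<^sub>R (\<Sum>j<m. (G ^^ (2 * j)) y)" for y
    unfolding C_def ey using m by (simp add: sum_subtractf scaleR_diff_right sum_constant_scaleR)
  have nC: "norm (C y) \<le> norm y" for y unfolding C by (rule avg) (rule nGj)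
  have nHHC: "norm (H (H (C y))) \<le> 2 / real m * norm y" for y
  proof -
    define z where "z = H (H (C y))"
    have z: "z = C y - G (C y)" by (simp add: z_def G_def)
    have "G (\<Sum>j<k. u j) = (\<Sum>j<k. G (u j))" for k and u :: "nat \<Rightarrow> 'a"
      by (induction k) (use sym_op_add[OF sG] sym_op_diff[OF sG, of 0 0] in auto)
    then have GGC: "G (G (C y)) = (1 / real m) *\<^sub>R (\<Sum>j<m. (G ^^ (2 * Suc j)) y)"
      by (simp add: C sym_op_scaleR[OF sG])
    \<comment> \<open>Here (1 + G)(1 - G) = 1 - G^2 is applied to the mean of the even powers, so
      that the sum telescopes.\<close>
    have "z + G z = C y - G (G (C y))" by (simp add: z sym_op_diff[OF sG])
    also have "\<dots> = (1 / real m) *\<^sub>R (\<Sum>j<m. (G ^^ (2 * j)) y - (G ^^ (2 * Suc j)) y)"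
      by (simp only: C GGC[unfolded C] sum_subtractf scaleR_diff_right)
    also have "\<dots> = (1 / real m) *\<^sub>R (y - (G ^^ (2 * m)) y)"
      by (subst sum_lessThan_telescope') simp
    finally have "norm (z + G z) = norm (y - (G ^^ (2 * m)) y) / real m" by simp
    also have "\<dots> \<le> (2 * norm y) / real m"
      using norm_triangle_ineq4[of y "(G ^^ (2 * m)) y"] nGj[of "2 * m" y]
      by (intro divide_right_mono) auto
    finally have 1: "norm (z + G z) \<le> 2 / real m * norm y" by simp
    \<comment> \<open>\<open>1 + G = 2 - h\<^sup>2\<close> is bounded below.\<close>
    have "2 *\<^sub>R z = (z + G z) + H (H z)" by (simp add: G_def scaleR_2)
    then have "2 * norm z \<le> norm (z + G z) + norm (H (H z))"
      by (metis norm_triangle_ineq norm_scaleR abs_numeral)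
    moreover have "norm (H (H z)) \<le> norm z" using nH order_trans by blast
    ultimately show ?thesis using 1 by (simp add: z_def)
  qed
  \<comment> \<open>The smallness of h^2 C passes to h C and then to \<open>adj a\<close> times C;
    each passage costs one square root.\<close>
  define \<kappa> where "\<kappa> = sqrt (sqrt (2 / real m))"
  have k0: "\<kappa> \<ge> 0" and k4: "\<kappa>\<^sup>2 * \<kappa>\<^sup>2 = 2 / real m"
    by (simp_all add: \<kappa>_def)
  have "norm ((adj a - adj a * e) * y) \<le> \<kappa> * norm y" for y
  proof -
    have "(norm (H (C y)))\<^sup>2 = norm (adj (C y) * H (H (C y)))"
      by (rule norm_sym_op_sq[OF sH])
    also have "\<dots> \<le> norm y * (2 / real m * norm y)"
      using nC[of y] nHHC[of y] norm_mult_ineq[of "adj (C y)" "H (H (C y))"]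
      by (smt (verit) mult_mono norm_adj norm_ge_zero)
    also have "\<dots> = (\<kappa>\<^sup>2 * norm y)\<^sup>2" by (simp add: k4[symmetric] power2_eq_square)
    finally have 1: "norm (H (C y)) \<le> \<kappa>\<^sup>2 * norm y"
      by (rule power2_le_imp_le) simp
    have "(norm (adj a * C y))\<^sup>2 = norm (adj (C y) * H (C y))"
      by (simp add: cstar_identity[symmetric] adj_mult adj_adj H_def h_def mult.assoc)
    also have "\<dots> \<le> norm y * (\<kappa>\<^sup>2 * norm y)"
      using nC[of y] 1 norm_mult_ineq[of "adj (C y)" "H (C y)"]
      by (smt (verit) mult_mono norm_adj norm_ge_zero)
    also have "\<dots> = (\<kappa> * norm y)\<^sup>2" by (simp add: power2_eq_square)
    finally have "norm (adj a * C y) \<le> \<kappa> * norm y"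
      by (rule power2_le_imp_le) (simp add: k0)
    then show ?thesis by (simp add: C_def left_diff_distrib right_diff_distrib mult.assoc)
  qed
  then have "norm (adj a - adj a * e) \<le> \<kappa>"
    by (rule norm_le_if_mult_le) (rule k0)
  moreover have "norm (adj e * a - a) = norm (adj a - adj a * e)"
    using norm_adj[of "adj e * a - a"] by (simp add: adj_diff adj_mult adj_adj norm_minus_commute)
  ultimately show ?thesis using eS ne by (auto simp: \<kappa>_def)
qed

text \<open>Rescaling to the unit ball reduces to the previous lemma with large \<open>m\<close>.
  The form \<open>adj e * a\<close> is chosen to match an off-diagonal entry of the Gram matrix of
  \<open>a\<close> and \<open>e\<close>.\<close>

lemma approximate_unit:
  assumes S: "cstar_algebra S" and a: "a \<in> S" and \<epsilon>: "\<epsilon> > 0"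
  shows "\<exists>e\<in>S. norm e \<le> 1 \<and> norm (adj e * a - a) < \<epsilon>"
proof -
  define r where "r = norm a + 1"
  have r: "r > 0" by (simp add: r_def add_nonneg_pos)
  define b where "b = inverse r *\<^sub>R a"
  have ab: "a = r *\<^sub>R b" using r by (simp add: b_def)
  have b: "b \<in> S" "norm b \<le> 1"
    using r by (simp_all add: b_def a cstar_algebra_scaleR[OF S]) (simp add: r_def field_simps)
  have "(\<lambda>m. sqrt (sqrt (2 * inverse (real (Suc m))))) \<longlonglongrightarrow> sqrt (sqrt (2 * 0))"
    by (intro tendsto_intros LIMSEQ_inverse_real_of_nat)
  then have "\<forall>\<^sub>F m in sequentially. sqrt (sqrt (2 * inverse (real (Suc m)))) < \<epsilon> / r"
    by (rule order_tendstoD) (use \<epsilon> r in simp)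
  then obtain m where m: "sqrt (sqrt (2 / real (Suc m))) < \<epsilon> / r"
    by (auto simp: eventually_sequentially divide_inverse)
  obtain e where e: "e \<in> S" "norm e \<le> 1" "norm (adj e * b - b) < \<epsilon> / r"
    using approximate_unit_contraction[OF S b, of "Suc m"] m by force
  have "norm (adj e * a - a) = r * norm (adj e * b - b)"
    using r by (simp add: ab scaleR_diff_right[symmetric])
  also have "\<dots> < \<epsilon>" using e(3) r by (simp add: field_simps)
  finally show ?thesis using e by blast
qed

section \<open>The Kadison-Schwarz inequality\<close>

lemma
  assumes "cpc_map S T f"
  shows cpc_map_closed: "\<And>x. x \<in> S \<Longrightarrow> f x \<in> T"
    and cpc_map_add: "\<And>x y. x \<in> S \<Longrightarrow> y \<in> S \<Longrightarrow> f (x + y) = f x + f y"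
    and cpc_map_scaleC: "\<And>c x. x \<in> S \<Longrightarrow> f (scaleC c x) = scaleC c (f x)"
    and cpc_map_scaleR: "\<And>r x. x \<in> S \<Longrightarrow> f (r *\<^sub>R x) = r *\<^sub>R f x"
    and cpc_map_norm: "\<And>x. x \<in> S \<Longrightarrow> norm (f x) \<le> norm x"
  using assms
  by (auto simp: cpc_map_def completely_positive_def clinear_map_def scaleR_scaleC)

lemma cpc_map_diff:
  assumes "cpc_map S T f" "cstar_algebra S" "x \<in> S" "y \<in> S"
  shows "f (x - y) = f x - f y"
  using cpc_map_add[OF assms(1), of "x - y" y] assms by (simp add: cstar_algebra_diff)

lemma adj_mat_mult_2:
  assumes "Y \<in> carrier_mat 2 2" "i < 2" "j < 2"
  shows "(adj_mat Y * Y) $$ (i, j) = adj (Y $$ (0, i)) * Y $$ (0, j) + adj (Y $$ (1, i)) * Y $$ (1, j)"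
  using assms by (simp add: adj_mat_def scalar_prod_def numeral_2_eq_2)

text \<open>With first row (a, e) and second row zero, \<open>adj_mat Y * Y\<close> is the Gram
  matrix of \<open>a\<close> and \<open>e\<close>. Its image under \<open>f\<close> is again a Gram
  matrix, of the columns (p, r) and (q, s).\<close>

lemma completely_positive_2:
  assumes f: "completely_positive S T f" and S: "cstar_algebra S" and a: "a \<in> S" "e \<in> S"
  obtains p q r s where "p \<in> T" "q \<in> T" "r \<in> T" "s \<in> T"
    "f (adj a * a) = adj p * p + adj r * r" "f (adj a * e) = adj p * q + adj r * s"
    "f (adj e * a) = adj q * p + adj s * r" "f (adj e * e) = adj q * q + adj s * s"
proof -
  define Y where "Y = mat 2 2 (\<lambda>(i, j). if i = 0 then if j = 0 then a else e else 0)"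
  have Y: "Y \<in> carrier_mat 2 2" by (simp add: Y_def)
  have "elements_mat Y \<subseteq> S"
    using a cstar_algebra_zero[OF S] by (auto simp: Y_def elements_mat_def)
  then have "positive_mat S 2 (adj_mat Y * Y)" using Y by (auto simp: positive_mat_def)
  then have "positive_mat T 2 (map_mat f (adj_mat Y * Y))"
    using f by (simp add: completely_positive_def)
  then obtain Z where Z: "Z \<in> carrier_mat 2 2" "elements_mat Z \<subseteq> T"
    and eq: "map_mat f (adj_mat Y * Y) = adj_mat Z * Z"
    by (auto simp: positive_mat_def)
  have ZT: "Z $$ (i, j) \<in> T" if "i < 2" "j < 2" for i j
    using Z(2) Z(1) that by (force simp: elements_mat_def)
  have "f ((adj_mat Y * Y) $$ (i, j)) = (adj_mat Z * Z) $$ (i, j)" if "i < 2" "j < 2" for i j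
    using that Y by (subst eq[symmetric]) (simp add: adj_mat_def)
  then have "f (adj (Y $$ (0, i)) * Y $$ (0, j) + adj (Y $$ (1, i)) * Y $$ (1, j))
      = adj (Z $$ (0, i)) * Z $$ (0, j) + adj (Z $$ (1, i)) * Z $$ (1, j)"
    if "i < 2" "j < 2" for i j
    using that by (simp add: adj_mat_mult_2 Y Z)
  from this[of 0 0] this[of 0 1] this[of 1 0] this[of 1 1] show thesis
    by (intro that[of "Z $$ (0, 0)" "Z $$ (0, 1)" "Z $$ (1, 0)" "Z $$ (1, 1)"] ZT)
      (simp_all add: Y_def)
qed

text \<open>The Gram form of the image gives \<open>f (adj x * e) = adj (f (adj e * x))\<close>, and
  \<open>adj e * x\<close> is as close to \<open>x\<close> as desired.\<close>

lemma cpc_map_adj: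
  assumes f: "cpc_map S T f" and S: "cstar_algebra S" and x: "x \<in> S"
  shows "f (adj x) = adj (f x)"
proof -
  have "norm (f (adj x) - adj (f x)) \<le> 0 + \<epsilon>" if "\<epsilon> > 0" for \<epsilon>
  proof -
    obtain e where e: "e \<in> S" and le: "norm (adj e * x - x) < \<epsilon> / 2"
      using approximate_unit[OF S x, of "\<epsilon> / 2"] \<open>\<epsilon> > 0\<close> by auto
    obtain p q r s where "f (adj x * e) = adj p * q + adj r * s" "f (adj e * x) = adj q * p + adj s * r"
      using completely_positive_2[OF _ S x e, of T f] f unfolding cpc_map_def by metis
    then have "f (adj x * e) = adj (f (adj e * x))" by (simp add: adj_add adj_mult adj_adj)
    then have "f (adj x) - adj (f x) = adj (f (adj e * x - x)) - f (adj x * e - adj x)"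
      using x e by (simp add: cpc_map_diff[OF f S] cstar_algebra_closed[OF S] adj_diff)
    also have "norm \<dots> \<le> norm (f (adj e * x - x)) + norm (f (adj x * e - adj x))"
      using norm_triangle_ineq4[of "adj (f (adj e * x - x))"] by simp
    also have "\<dots> \<le> norm (adj e * x - x) + norm (adj x * e - adj x)"
      using x e by (intro add_mono cpc_map_norm[OF f] cstar_algebra_closed[OF S])
    also have "norm (adj x * e - adj x) = norm (adj e * x - x)"
      using norm_adj[of "adj e * x - x"] by (simp add: adj_diff adj_mult adj_adj)
    finally show ?thesis using le by simp
  qed
  then have "norm (f (adj x) - adj (f x)) \<le> 0" by (rule field_le_epsilon)
  then show ?thesis by simp
qed

text \<open>Real-valued, since real parts of vector states are all that is tested. \<open>K\<close>
  bounds the norm; by linearity the one-sided bound is two-sided on a subspace.\<close>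

definition pos_functional :: "'a::pre_cstar_algebra set \<Rightarrow> real \<Rightarrow> ('a \<Rightarrow> real) \<Rightarrow> bool" where
  "pos_functional S K \<omega> \<longleftrightarrow>
     (\<forall>x\<in>S. \<forall>y\<in>S. \<omega> (x + y) = \<omega> x + \<omega> y) \<and> (\<forall>r. \<forall>x\<in>S. \<omega> (r *\<^sub>R x) = r * \<omega> x) \<and>
     (\<forall>x\<in>S. 0 \<le> \<omega> (adj x * x)) \<and> 0 \<le> K \<and> (\<forall>x\<in>S. \<omega> x \<le> K * norm x)"

lemma
  assumes "pos_functional S K \<omega>"
  shows pos_functional_add: "\<And>x y. x \<in> S \<Longrightarrow> y \<in> S \<Longrightarrow> \<omega> (x + y) = \<omega> x + \<omega> y"
    and pos_functional_scaleR: "\<And>r x. x \<in> S \<Longrightarrow> \<omega> (r *\<^sub>R x) = r * \<omega> x"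
    and pos_functional_nonneg: "\<And>x. x \<in> S \<Longrightarrow> 0 \<le> \<omega> (adj x * x)"
    and pos_functional_bound_nonneg: "0 \<le> K"
    and pos_functional_bound: "\<And>x. x \<in> S \<Longrightarrow> \<omega> x \<le> K * norm x"
  using assms by (auto simp: pos_functional_def)

lemma pos_functional_diff:
  assumes "pos_functional S K \<omega>" "cstar_algebra S" "x \<in> S" "y \<in> S"
  shows "\<omega> (x - y) = \<omega> x - \<omega> y"
  using pos_functional_add[OF assms(1), of "x - y" y] assms by (simp add: cstar_algebra_diff)

lemma pos_functional_compose:
  assumes \<omega>: "pos_functional T K \<omega>" and f: "cpc_map S T f"
    and S: "cstar_algebra S" and T: "cstar_algebra T"
  shows "pos_functional S K (\<lambda>x. \<omega> (f x))"
  unfolding pos_functional_def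
proof (intro conjI ballI allI)
  fix x assume x: "x \<in> S"
  \<comment> \<open>Taking both elements equal to \<open>x\<close> extracts ordinary positivity, as
    a sum of two squares.\<close>
  obtain p q r s where "p \<in> T" "r \<in> T" "f (adj x * x) = adj p * p + adj r * r"
    using completely_positive_2[OF _ S x x, of T f] f unfolding cpc_map_def by metis
  then show "0 \<le> \<omega> (f (adj x * x))"
    by (simp add: pos_functional_add[OF \<omega>] pos_functional_nonneg[OF \<omega>] cstar_algebra_closed[OF T])
  have "\<omega> (f x) \<le> K * norm (f x)"
    using x by (intro pos_functional_bound[OF \<omega>] cpc_map_closed[OF f])
  also have "\<dots> \<le> K * norm x"
    by (intro mult_left_mono cpc_map_norm[OF f] x pos_functional_bound_nonneg[OF \<omega>])
  finally show "\<omega> (f x) \<le> K * norm x" .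
qed (use pos_functional_bound_nonneg[OF \<omega>] in
    \<open>simp_all add: cpc_map_add[OF f] cpc_map_scaleR[OF f] cpc_map_closed[OF f]
      pos_functional_add[OF \<omega>] pos_functional_scaleR[OF \<omega>]\<close>)

lemma discriminant_le:
  fixes a b c :: real
  assumes "\<And>t. 0 \<le> a + 2 * t * b + t\<^sup>2 * c" "0 \<le> c"
  shows "b\<^sup>2 \<le> a * c"
proof (cases "c = 0")
  case True
  have "b = 0"
  proof (rule ccontr)
    assume "b \<noteq> 0"
    \<comment> \<open>At this \<open>t\<close> the affine expression equals -1.\<close>
    with assms(1)[of "- (a + 1) / (2 * b)"] True show False by (simp add: field_simps)
  qed
  with True show ?thesis by simp
next
  case False
  with assms(2) have c: "c > 0" by simp
  have "0 \<le> (a + 2 * (- b / c) * b + (- b / c)\<^sup>2 * c) * c"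
    using assms(1)[of "- b / c"] c by simp
  also have "\<dots> = a * c - b\<^sup>2" using c by (simp add: field_simps power2_eq_square)
  finally show ?thesis by simp
qed

text \<open>
  In terms of the columns \<open>P = (p, r)\<close> and \<open>Q = (q, s)\<close>, this is \<open>\<omega>(P\<^sup>* Q Q\<^sup>* P) \<le> \<omega>(P\<^sup>* P)\<close> if
  \<open>norm (Q\<^sup>* Q) \<le> 1\<close>. By the Cauchy-Schwarz inequality, if it failed then
  \<open>\<omega>(P\<^sup>* (Q Q\<^sup>*)\<^sup>k P)\<close> would be unbounded along \<open>k = 2\<^sup>j\<close>. In the proof, \<open>\<alpha> k\<close> is this quantity
  with exponent \<open>k + 1\<close>.
\<close>

lemma pos_functional_Bessel:
  assumes \<omega>: "pos_functional T K \<omega>" and T: "cstar_algebra T"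
    and pqrs: "p \<in> T" "q \<in> T" "r \<in> T" "s \<in> T"
    and d: "norm (adj q * q + adj s * s) \<le> 1"
  shows "\<omega> (adj (adj q * p + adj s * r) * (adj q * p + adj s * r)) \<le> \<omega> (adj p * p + adj r * r)"
proof -
  note cl = cstar_algebra_closed[OF T]
  define d where "d = adj q * q + adj s * s"
  define v where "v = adj q * p + adj s * r"
  define u where "u k = ((*) d ^^ k) v" for k
  define \<alpha> where "\<alpha> k = \<omega> (adj v * u k)" for k
  define A where "A = \<omega> (adj p * p + adj r * r)"
  have dT: "d \<in> T" and vT: "v \<in> T" by (simp_all add: d_def v_def pqrs cl)
  have uT: "u k \<in> T" for k by (induction k) (simp_all add: u_def vT dT cl)
  have adj_d: "adj d = d" by (simp add: d_def adj_add adj_mult adj_adj)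
  have uu: "adj (u k) * u l = adj v * u (k + l)" for k l
  proof (induction k arbitrary: l)
    case (Suc k)
    have "adj (u (Suc k)) * u l = adj (u k) * u (Suc l)"
      by (simp add: u_def adj_mult adj_d mult.assoc)
    with Suc[of "Suc l"] show ?case by simp
  qed (simp add: u_def)
  have nu: "norm (u k) \<le> norm v" for k
  proof (induction k)
    case (Suc k)
    have "norm (u (Suc k)) \<le> norm d * norm (u k)" by (simp add: u_def norm_mult_ineq)
    also have "\<dots> \<le> 1 * norm (u k)" using assms(7) by (intro mult_right_mono) (simp_all add: d_def)
    finally show ?case using Suc by simp
  qed (simp add: u_def)
  have \<alpha>_le: "\<alpha> k \<le> K * (norm v * norm v)" for k
  proof -
    have "\<alpha> k \<le> K * norm (adj v * u k)"
      unfolding \<alpha>_def by (rule pos_functional_bound[OF \<omega>]) (simp add: vT uT cl)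
    also have "\<dots> \<le> K * (norm v * norm v)"
      using norm_mult_ineq[of "adj v" "u k"] mult_left_mono[OF nu[of k], of "norm v"]
      by (intro mult_left_mono pos_functional_bound_nonneg[OF \<omega>]) simp
    finally show ?thesis .
  qed
  have A0: "A \<ge> 0"
    by (simp add: A_def pqrs cl pos_functional_add[OF \<omega>] pos_functional_nonneg[OF \<omega>])
  \<comment> \<open>Cauchy-Schwarz for the columns P and Q u_k: their mixed product is
    \<open>adj v * u k\<close>, and the square of Q u_k is \<open>adj v * u (Suc (2 * k))\<close>.
    Positivity on P + t Q u_k is a quadratic condition in \<open>t\<close>.\<close>
  have step: "(\<alpha> k)\<^sup>2 \<le> A * \<alpha> (Suc (2 * k))" for k
  proof (rule discriminant_le)
    let ?x = "q * u k" and ?y = "s * u k"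
    have sq: "adj ?x * ?x + adj ?y * ?y = adj v * u (Suc (2 * k))"
    proof -
      have "adj ?x * ?x + adj ?y * ?y = adj (u k) * u (Suc k)"
        by (simp add: adj_mult u_def d_def distrib_left distrib_right mult.assoc)
      then show ?thesis by (simp add: uu mult_2)
    qed
    have cross: "adj p * ?x + adj r * ?y = adj v * u k"
      by (simp add: v_def adj_add adj_mult adj_adj distrib_right mult.assoc)
    have cross': "adj ?x * p + adj ?y * r = adj v * u k"
    proof -
      have "adj ?x * p + adj ?y * r = adj (u k) * u 0"
        by (simp add: u_def v_def adj_mult distrib_left mult.assoc)
      then show ?thesis by (simp add: uu)
    qed
    show "0 \<le> \<alpha> (Suc (2 * k))"
      unfolding \<alpha>_def sq[symmetric]
      by (simp add: pqrs uT cl pos_functional_add[OF \<omega>] pos_functional_nonneg[OF \<omega>])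
    fix t
    let ?X = "p + t *\<^sub>R ?x" and ?Y = "r + t *\<^sub>R ?y"
    have "adj ?X * ?X + adj ?Y * ?Y
        = (adj p * p + adj r * r) + t *\<^sub>R ((adj p * ?x + adj r * ?y) + (adj ?x * p + adj ?y * r))
          + t\<^sup>2 *\<^sub>R (adj ?x * ?x + adj ?y * ?y)"
      by (simp add: adj_add adj_scaleR distrib_left distrib_right scaleR_add_right power2_eq_square add_ac)
    also have "\<dots> = (adj p * p + adj r * r) + (2 * t) *\<^sub>R (adj v * u k) + t\<^sup>2 *\<^sub>R (adj v * u (Suc (2 * k)))"
      unfolding cross cross' sq by (simp add: scaleR_2[symmetric])
    finally have "\<omega> (adj ?X * ?X + adj ?Y * ?Y) = A + 2 * t * \<alpha> k + t\<^sup>2 * \<alpha> (Suc (2 * k))"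
      by (simp add: A_def \<alpha>_def pqrs uT vT cl pos_functional_add[OF \<omega>] pos_functional_scaleR[OF \<omega>])
    moreover have "0 \<le> \<omega> (adj ?X * ?X + adj ?Y * ?Y)"
      by (simp add: pqrs uT cl pos_functional_add[OF \<omega>] pos_functional_nonneg[OF \<omega>])
    ultimately show "0 \<le> A + 2 * t * \<alpha> k + t\<^sup>2 * \<alpha> (Suc (2 * k))" by simp
  qed
  have "\<alpha> 0 \<le> A"
  proof (rule ccontr)
    assume "\<not> \<alpha> 0 \<le> A"
    \<comment> \<open>If \<open>A = 0\<close>, then \<open>step\<close> at 0 forces
      \<open>\<alpha> 0 = 0\<close>, which contradicts the assumption.\<close>
    with A0 step[of 0] have A: "A > 0" "\<alpha> 0 > A" by (cases "A = 0"; force)+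
    define \<beta> where "\<beta> = \<alpha> 0 / A"
    have \<beta>: "\<beta> > 1" using A by (simp add: \<beta>_def)
    \<comment> \<open>The indices \<open>2 ^ j - 1\<close> are closed under k -> 2 k + 1, so each
      use of \<open>step\<close> squares the lower bound \<beta> for the initial ratio \<alpha> / A.
      This growth violates \<open>\<alpha>_le\<close>.\<close>
    have grow: "A * \<beta> ^ 2 ^ j \<le> \<alpha> (2 ^ j - 1)" for j
    proof (induction j)
      case (Suc j)
      have "A * (A * \<beta> ^ 2 ^ Suc j) = (A * \<beta> ^ 2 ^ j)\<^sup>2"
        by (simp add: power2_eq_square power_mult mult.commute mult.left_commute power_add[symmetric] mult_2[symmetric])
      also have "\<dots> \<le> (\<alpha> (2 ^ j - 1))\<^sup>2"
        using Suc A \<beta> by (intro power_mono) auto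
      also have "\<dots> \<le> A * \<alpha> (Suc (2 * (2 ^ j - 1)))" by (rule step)
      also have "Suc (2 * (2 ^ j - 1)) = 2 ^ Suc j - (1::nat)"
        unfolding power_Suc using one_le_power[of "2::nat" j] by arith
      finally show ?case using A by simp
    qed (use A in \<open>simp add: \<beta>_def\<close>)
    obtain j where j: "K * (norm v * norm v) / A < \<beta> ^ j" using real_arch_pow[OF \<beta>] by blast
    have "\<beta> ^ j \<le> \<beta> ^ 2 ^ j"
      using \<beta> by (intro power_increasing) (auto intro: less_imp_le less_exp)
    with j have "K * (norm v * norm v) / A < \<beta> ^ 2 ^ j" by simp
    then have "K * (norm v * norm v) < A * \<beta> ^ 2 ^ j" using A by (simp add: field_simps)
    with grow[of j] \<alpha>_le[of "2 ^ j - 1"] show False by simp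
  qed
  then show ?thesis by (simp add: \<alpha>_def u_def A_def v_def)
qed

text \<open>The Bessel inequality is applied to the Gram matrix of \<open>a\<close> and
  \<open>e\<close>: P has square \<open>f (adj a * a)\<close>, Q has square
  \<open>f (adj e * e)\<close> of norm at most 1, and their product \<open>f (adj e * a)\<close>
  approximates \<open>f a\<close>.\<close>

lemma Kadison_Schwarz:
  assumes f: "cpc_map S T f" and S: "cstar_algebra S" and T: "cstar_algebra T"
    and \<omega>: "pos_functional T K \<omega>" and a: "a \<in> S"
  shows "\<omega> (adj (f a) * f a) \<le> \<omega> (f (adj a * a))"
proof (rule field_le_epsilon)
  fix \<epsilon> :: real assume \<epsilon>: "\<epsilon> > 0"
  note cl = cstar_algebra_closed[OF S] and clT = cstar_algebra_closed[OF T]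
  have K: "K \<ge> 0" by (rule pos_functional_bound_nonneg[OF \<omega>])
  \<comment> \<open>The map taking \<open>b\<close> to \<open>\<omega> (adj (f b) * f b)\<close> has
    Lipschitz constant at most \<open>K * (2 * norm a)\<close> on the ball of radius
    \<open>norm a\<close>; the added 1 keeps the denominator positive.\<close>
  define \<delta> where "\<delta> = \<epsilon> / (K * (2 * norm a) + 1)"
  have den: "K * (2 * norm a) + 1 > 0" using K by (simp add: add_nonneg_pos)
  have \<delta>: "\<delta> > 0" using \<epsilon> den by (simp add: \<delta>_def)
  obtain e where e: "e \<in> S" "norm e \<le> 1" "norm (adj e * a - a) < \<delta>"
    using approximate_unit[OF S a \<delta>] by blast
  define b where "b = adj e * a"
  have bS: "b \<in> S" by (simp add: b_def e a cl)
  have nb: "norm b \<le> norm a"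
    using norm_mult_ineq[of "adj e" a] mult_right_mono[OF e(2), of "norm a"] by (simp add: b_def)
  obtain p q r s where pqrs: "p \<in> T" "q \<in> T" "r \<in> T" "s \<in> T"
    and fs: "f (adj a * a) = adj p * p + adj r * r" "f (adj e * a) = adj q * p + adj s * r"
      "f (adj e * e) = adj q * q + adj s * s"
    using completely_positive_2[OF _ S a e(1), of T f] f unfolding cpc_map_def by metis
  have "norm (f (adj e * e)) \<le> (norm e)\<^sup>2"
    using cpc_map_norm[OF f, of "adj e * e"] e by (simp add: cl cstar_identity)
  also have "\<dots> \<le> 1" using e by (simp add: power_le_one)
  finally have "\<omega> (adj (f b) * f b) \<le> \<omega> (f (adj a * a))"
    using pos_functional_Bessel[OF \<omega> T pqrs] by (simp add: fs b_def)
  moreover have "\<omega> (adj (f a) * f a) - \<omega> (adj (f b) * f b) \<le> \<epsilon>"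
  proof -
    have fab: "f a \<in> T" "f b \<in> T" using a bS by (simp_all add: cpc_map_closed[OF f])
    have nf: "norm (f a) \<le> norm a" "norm (f b) \<le> norm a" "norm (f a - f b) \<le> \<delta>"
      using cpc_map_norm[OF f a] cpc_map_norm[OF f bS] nb
        cpc_map_norm[OF f, of "a - b"] e(3) a bS
      by (simp_all add: cpc_map_diff[OF f S] cl b_def norm_minus_commute)
    have "\<omega> (adj (f a) * f a) - \<omega> (adj (f b) * f b) = \<omega> (adj (f a) * f a - adj (f b) * f b)"
      by (simp add: pos_functional_diff[OF \<omega> T] clT fab)
    also have "\<dots> \<le> K * norm (adj (f a) * f a - adj (f b) * f b)"
      by (rule pos_functional_bound[OF \<omega>]) (simp add: clT fab)
    also have "adj (f a) * f a - adj (f b) * f b = adj (f a) * (f a - f b) + adj (f a - f b) * f b"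
      by (simp add: adj_diff algebra_simps)
    also have "norm \<dots> \<le> norm a * \<delta> + \<delta> * norm a"
      using nf \<delta>
      by (intro order_trans[OF norm_triangle_ineq] add_mono order_trans[OF norm_mult_ineq] mult_mono) auto
    also have "K * (norm a * \<delta> + \<delta> * norm a) = K * (2 * norm a) * \<delta>" by simp
    also have "\<dots> \<le> (K * (2 * norm a) + 1) * \<delta>" using \<delta> by simp
    also have "\<dots> = \<epsilon>" using den by (simp add: \<delta>_def)
    finally show ?thesis using K by (simp add: mult_left_mono)
  qed
  ultimately show "\<omega> (adj (f a) * f a) \<le> \<omega> (f (adj a * a)) + \<epsilon>" by linarith
qed

section \<open>Norm bounds in nuclear algebras\<close>

definition rip :: "nat \<Rightarrow> (nat \<Rightarrow> complex) \<Rightarrow> (nat \<Rightarrow> complex) \<Rightarrow> real" where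
  "rip k u v = Re (\<Sum>i<k. u i * cnj (v i))"

lemma rip_self: "rip k u u = (vnorm k u)\<^sup>2"
  by (simp add: rip_def L2_set_def sum_nonneg complex_mult_cnj cmod_power2)

lemma rip_commute: "rip k u v = rip k v u"
  by (simp add: rip_def mult.commute)

lemma rip_add_left: "rip k (\<lambda>i. u i + v i) w = rip k u w + rip k v w"
  by (simp add: rip_def distrib_right sum.distrib)

lemma rip_diff_left: "rip k (\<lambda>i. u i - v i) w = rip k u w - rip k v w"
  by (simp add: rip_def left_diff_distrib sum_subtractf)

lemma rip_scale_left: "rip k (\<lambda>i. complex_of_real r * u i) w = r * rip k u w"
  by (simp add: rip_def mult.assoc sum_distrib_left[symmetric] del: Re_sum)

lemma rip_le: "rip k u v \<le> vnorm k u * vnorm k v"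
proof -
  have "rip k u v \<le> cmod (\<Sum>i<k. u i * cnj (v i))" unfolding rip_def by (rule complex_Re_le_cmod)
  also have "\<dots> \<le> (\<Sum>i<k. \<bar>cmod (u i)\<bar> * \<bar>cmod (v i)\<bar>)"
    by (rule order_trans[OF norm_sum]) (simp add: norm_mult)
  also have "\<dots> \<le> vnorm k u * vnorm k v" by (rule L2_set_mult_ineq)
  finally show ?thesis .
qed

lemma rip_mstar:
  assumes "supp_in k f"
  shows "rip k (mapply (mstar f) u) v = rip k u (mapply f v)"
proof -
  have "(\<Sum>l<k. mapply (mstar f) u l * cnj (v l)) = (\<Sum>l<k. \<Sum>i<k. u i * (cnj (f i l) * cnj (v l)))"
    unfolding mapply_eq[OF supp_in_mstar[OF assms]] mstar_def sum_distrib_right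
    by (intro sum.cong refl) (simp add: mult_ac)
  also have "\<dots> = (\<Sum>i<k. \<Sum>l<k. u i * (cnj (f i l) * cnj (v l)))" by (rule sum.swap)
  also have "\<dots> = (\<Sum>i<k. u i * cnj (mapply f v i))"
    by (simp add: mapply_eq[OF assms] sum_distrib_left)
  finally show ?thesis by (simp add: rip_def)
qed

lemma mapply_scale_diff:
  "mapply f (\<lambda>i. complex_of_real c * u i - v i) = (\<lambda>i. complex_of_real c * mapply f u i - mapply f v i)"
  by (rule ext) (simp add: mapply_def right_diff_distrib sum_subtractf sum_distrib_left mult.left_commute)

text \<open>For 0 \<le> X \<le> c, positivity of the form at (c - X) u, with its upper bound at u
  and at X u, gives |X u| \<le> c |u| without diagonalizing.\<close>

lemma norm_fin_matrix_le:
  assumes X: "supp_in k (entry X)" "adj X = X" and c: "c > 0"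
    and q: "\<And>u. 0 \<le> rip k (mapply (entry X) u) u" "\<And>u. rip k (mapply (entry X) u) u \<le> c * (vnorm k u)\<^sup>2"
  shows "norm X \<le> c"
  unfolding norm_fin_matrix.rep_eq
proof (rule mopnorm_least[OF X(1)])
  fix u
  let ?M = "mapply (entry X)"
  have sym: "rip k (?M v) w = rip k v (?M w)" for v w
    using rip_mstar[OF X(1), of v w] X(2) by (metis adj_fin_matrix.rep_eq)
  let ?w = "\<lambda>i. complex_of_real c * u i - ?M u i"
  have "0 \<le> rip k (?M ?w) ?w" by (rule q)
  also have "rip k (?M ?w) ?w = c * (c * rip k (?M u) u) - 2 * c * rip k (?M u) (?M u) + rip k (?M (?M u)) (?M u)"
    unfolding mapply_scale_diff
    by (simp add: rip_diff_left rip_scale_left rip_commute[of k _ ?w] sym algebra_simps)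
  also have "\<dots> \<le> c * (c * (c * (vnorm k u)\<^sup>2)) - 2 * c * (vnorm k (?M u))\<^sup>2 + c * (vnorm k (?M u))\<^sup>2"
    unfolding rip_self by (intro add_mono diff_right_mono mult_left_mono q) (use c in simp_all)
  also have "\<dots> = c * ((c * vnorm k u)\<^sup>2 - (vnorm k (?M u))\<^sup>2)"
    by (simp add: algebra_simps power2_eq_square)
  finally have "(vnorm k (?M u))\<^sup>2 \<le> (c * vnorm k u)\<^sup>2" using c by (simp add: zero_le_mult_iff)
  then show "vnorm k (?M u) \<le> c * vnorm k u"
    by (rule power2_le_imp_le) (use c in \<open>simp add: L2_set_nonneg\<close>)
qed (use c in simp)

lemma vector_state_pos_functional:
  assumes \<sigma>: "cpc_map A (matrix_algebra k) \<sigma>" and A: "cstar_algebra A"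
  shows "pos_functional A ((vnorm k u)\<^sup>2) (\<lambda>x. rip k (mapply (entry (\<sigma> x)) u) u)"
  unfolding pos_functional_def
proof (intro conjI ballI allI)
  have supp: "supp_in k (entry X)" if "X \<in> matrix_algebra k" for X
    using that by (simp add: matrix_algebra_def supp_in_def)
  note supp\<sigma> = supp[OF cpc_map_closed[OF \<sigma>]]
  have add: "mapply (entry (X + Y)) u = (\<lambda>i. mapply (entry X) u i + mapply (entry Y) u i)"
    if "supp_in k (entry X)" "supp_in k (entry Y)" for X Y
  proof -
    have "supp_in k (entry (X + Y))"
      using that unfolding supp_in_def plus_fin_matrix.rep_eq by (metis add.right_neutral)
    then show ?thesis
      by (intro ext, simp only: mapply_eq[OF that(1)] mapply_eq[OF that(2)] mapply_eq)
        (simp add: plus_fin_matrix.rep_eq distrib_right sum.distrib)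
  qed
  {
    fix x y assume "x \<in> A" "y \<in> A"
    then show "rip k (mapply (entry (\<sigma> (x + y))) u) u
        = rip k (mapply (entry (\<sigma> x)) u) u + rip k (mapply (entry (\<sigma> y)) u) u"
      by (simp add: cpc_map_add[OF \<sigma>] add supp\<sigma> rip_add_left)
  next
    fix r x assume x: "x \<in> A"
    have "supp_in k (entry (r *\<^sub>R \<sigma> x))"
      using supp\<sigma>[OF x] by (auto simp: supp_in_def scaleR_scaleC scaleC_fin_matrix.rep_eq)
    then have "mapply (entry (r *\<^sub>R \<sigma> x)) u = (\<lambda>i. complex_of_real r * mapply (entry (\<sigma> x)) u i)"
      by (intro ext, simp only: mapply_eq[OF supp\<sigma>[OF x]] mapply_eq)
        (simp add: scaleR_scaleC scaleC_fin_matrix.rep_eq sum_distrib_left mult.assoc)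
    then show "rip k (mapply (entry (\<sigma> (r *\<^sub>R x))) u) u = r * rip k (mapply (entry (\<sigma> x)) u) u"
      by (simp add: cpc_map_scaleR[OF \<sigma> x] rip_scale_left)
  next
    fix x assume x: "x \<in> A"
    obtain p q r s where pr: "p \<in> matrix_algebra k" "r \<in> matrix_algebra k"
      and eq: "\<sigma> (adj x * x) = adj p * p + adj r * r"
      using completely_positive_2[OF _ A x x, of "matrix_algebra k" \<sigma>] \<sigma> unfolding cpc_map_def by metis
    have sq: "rip k (mapply (entry (adj p * p)) u) u = (vnorm k (mapply (entry p) u))\<^sup>2"
      and supp_sq: "supp_in k (entry (adj p * p))" if "p \<in> matrix_algebra k" for p
      using supp[OF that] mapply_mprod[OF supp_in_mstar[OF supp[OF that]] supp[OF that]]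
      by (simp_all add: times_fin_matrix.rep_eq adj_fin_matrix.rep_eq supp_in_mstar
          rip_mstar rip_self supp_in_mprod)
    show "0 \<le> rip k (mapply (entry (\<sigma> (adj x * x))) u) u"
      unfolding eq by (simp add: add supp_sq pr rip_add_left sq)
  next
    fix x assume x: "x \<in> A"
    have "rip k (mapply (entry (\<sigma> x)) u) u \<le> vnorm k (mapply (entry (\<sigma> x)) u) * vnorm k u"
      by (rule rip_le)
    also have "\<dots> \<le> (norm (\<sigma> x) * vnorm k u) * vnorm k u"
      unfolding norm_fin_matrix.rep_eq
      by (intro mult_right_mono mopnorm_bound[OF supp\<sigma>[OF x]]) simp
    also have "\<dots> \<le> (norm x * vnorm k u) * vnorm k u"
      by (intro mult_right_mono cpc_map_norm[OF \<sigma> x]) simp_all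
    finally show "rip k (mapply (entry (\<sigma> x)) u) u \<le> (vnorm k u)\<^sup>2 * norm x"
      by (simp add: power2_eq_square mult_ac)
  }
qed simp

text \<open>Since \<tau> is contractive and \<tau> \<sigma> x is near \<open>x\<close>, the norm of
  \<open>x\<close> is nearly at most that of \<sigma> x, a self-adjoint matrix whose quadratic form
  is a family of positive functionals on \<open>A\<close>.\<close>

lemma nuclear_norm_le:
  assumes A: "cstar_algebra A" "nuclear A" and x: "x \<in> A" "adj x = x" and c: "c \<ge> 0"
    and \<omega>: "\<And>K \<omega>. pos_functional A K \<omega> \<Longrightarrow> 0 \<le> \<omega> x \<and> \<omega> x \<le> K * c"
  shows "norm x \<le> c"
proof (rule field_le_epsilon)
  fix \<epsilon> :: real assume "\<epsilon> > 0"
  then obtain k \<sigma> \<tau> where \<sigma>: "cpc_map A (matrix_algebra k) \<sigma>" and \<tau>: "cpc_map (matrix_algebra k) A \<tau>"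
    and near: "norm (\<tau> (\<sigma> x) - x) < \<epsilon> / 2"
    using A(2)[unfolded nuclear_def, rule_format, of "{x}" "\<epsilon> / 2"] x by auto
  have X: "\<sigma> x \<in> matrix_algebra k" by (rule cpc_map_closed[OF \<sigma> x(1)])
  \<comment> \<open>The slack also makes the bound strictly positive when \<open>c = 0\<close>, as
    the matrix lemma requires.\<close>
  have "norm (\<sigma> x) \<le> c + \<epsilon> / 2"
  proof (rule norm_fin_matrix_le)
    show "supp_in k (entry (\<sigma> x))" using X by (simp add: matrix_algebra_def supp_in_def)
    show "adj (\<sigma> x) = \<sigma> x" using cpc_map_adj[OF \<sigma> A(1) x(1)] x(2) by simp
    fix u
    note * = \<omega>[OF vector_state_pos_functional[OF \<sigma> A(1), of u]]
    show "0 \<le> rip k (mapply (entry (\<sigma> x)) u) u" using * by blast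
    have "(vnorm k u)\<^sup>2 * c \<le> (c + \<epsilon> / 2) * (vnorm k u)\<^sup>2"
      using \<open>\<epsilon> > 0\<close> by (simp add: algebra_simps)
    with * show "rip k (mapply (entry (\<sigma> x)) u) u \<le> (c + \<epsilon> / 2) * (vnorm k u)\<^sup>2" by linarith
  qed (use c \<open>\<epsilon> > 0\<close> in simp)
  moreover have "norm (\<tau> (\<sigma> x)) \<le> norm (\<sigma> x)" by (rule cpc_map_norm[OF \<tau> X])
  moreover have "norm x \<le> norm (\<tau> (\<sigma> x)) + norm (\<tau> (\<sigma> x) - x)"
    using norm_triangle_ineq4[of "\<tau> (\<sigma> x)" "\<tau> (\<sigma> x) - x"] by simp
  ultimately show "norm x \<le> c + \<epsilon>" using near by linarith
qed

section \<open>Summable systems\<close>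

text \<open>The Schwarz inequality for \<psi> makes the left-hand element positive under every
  functional; the one for \<phi> bounds it by the outer gap on the right.\<close>

lemma norm_Schwarz_defect_le:
  assumes A: "cstar_algebra A" "nuclear A" and F: "cstar_algebra F"
    and \<psi>: "cpc_map A F \<psi>" and \<phi>: "cpc_map F A \<phi>" and a: "a \<in> A"
  shows "norm (\<phi> (\<psi> (adj a * a) - adj (\<psi> a) * \<psi> a))
       \<le> norm (\<phi> (\<psi> (adj a * a)) - adj (\<phi> (\<psi> a)) * \<phi> (\<psi> a))"
proof (rule nuclear_norm_le[OF A])
  note clA = cstar_algebra_closed[OF A(1)] and clF = cstar_algebra_closed[OF F]
  have aa: "adj a * a \<in> A" and pa: "\<psi> a \<in> F" and paa: "\<psi> (adj a * a) \<in> F"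
    and sq: "adj (\<psi> a) * \<psi> a \<in> F"
    using a by (simp_all add: clA clF cpc_map_closed[OF \<psi>])
  have d: "\<psi> (adj a * a) - adj (\<psi> a) * \<psi> a \<in> F" by (simp add: clF paa sq)
  show dA: "\<phi> (\<psi> (adj a * a) - adj (\<psi> a) * \<psi> a) \<in> A" by (rule cpc_map_closed[OF \<phi> d])
  show "adj (\<phi> (\<psi> (adj a * a) - adj (\<psi> a) * \<psi> a)) = \<phi> (\<psi> (adj a * a) - adj (\<psi> a) * \<psi> a)"
    by (simp add: cpc_map_adj[OF \<phi> F d, symmetric] adj_diff adj_mult adj_adj
        cpc_map_adj[OF \<psi> A(1) aa, symmetric])
  fix K \<omega> assume \<omega>: "pos_functional A K \<omega>"
  \<comment> \<open>The inequality for \<psi> lives in \<open>F\<close>, where it is tested on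
    \<omega> composed with \<phi>.\<close>
  note \<omega>\<phi> = pos_functional_compose[OF \<omega> \<phi> F A(1)]
  have 1: "\<omega> (\<phi> (adj (\<psi> a) * \<psi> a)) \<le> \<omega> (\<phi> (\<psi> (adj a * a)))"
    by (rule Kadison_Schwarz[OF \<psi> A(1) F \<omega>\<phi> a])
  have 2: "\<omega> (adj (\<phi> (\<psi> a)) * \<phi> (\<psi> a)) \<le> \<omega> (\<phi> (adj (\<psi> a) * \<psi> a))"
    by (rule Kadison_Schwarz[OF \<phi> F A(1) \<omega> pa])
  have diff: "\<omega> (\<phi> (\<psi> (adj a * a) - adj (\<psi> a) * \<psi> a)) = \<omega> (\<phi> (\<psi> (adj a * a))) - \<omega> (\<phi> (adj (\<psi> a) * \<psi> a))"
    by (rule pos_functional_diff[OF \<omega>\<phi> F paa sq])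
  have "\<omega> (\<phi> (\<psi> (adj a * a))) - \<omega> (adj (\<phi> (\<psi> a)) * \<phi> (\<psi> a))
      = \<omega> (\<phi> (\<psi> (adj a * a)) - adj (\<phi> (\<psi> a)) * \<phi> (\<psi> a))"
    by (simp add: pos_functional_diff[OF \<omega> A(1)] clA cpc_map_closed[OF \<phi>] paa pa)
  also have "\<dots> \<le> K * norm (\<phi> (\<psi> (adj a * a)) - adj (\<phi> (\<psi> a)) * \<phi> (\<psi> a))"
    by (rule pos_functional_bound[OF \<omega>]) (simp add: clA cpc_map_closed[OF \<phi>] paa pa)
  finally show "0 \<le> \<omega> (\<phi> (\<psi> (adj a * a) - adj (\<psi> a) * \<psi> a))
      \<and> \<omega> (\<phi> (\<psi> (adj a * a) - adj (\<psi> a) * \<psi> a))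
        \<le> K * norm (\<phi> (\<psi> (adj a * a)) - adj (\<phi> (\<psi> a)) * \<phi> (\<psi> a))"
    using 1 2 diff by linarith
qed simp

lemma polarization:
  fixes a b :: "'a::pre_cstar_algebra"
  shows "scaleC 2 (adj a * b)
    = (adj (a + b) * (a + b) - adj a * a - adj b * b)
      - scaleC \<i> (adj (a + scaleC \<i> b) * (a + scaleC \<i> b) - adj a * a - adj b * b)"
proof -
  have 1: "adj (a + b) * (a + b) - adj a * a - adj b * b = adj a * b + adj b * a"
    by (simp add: adj_add distrib_left distrib_right)
  have 2: "adj (a + scaleC \<i> b) * (a + scaleC \<i> b) - adj a * a - adj b * b
      = scaleC \<i> (adj a * b) + scaleC (- \<i>) (adj b * a)"
    by (simp add: adj_add adj_scaleC distrib_left distrib_right left_diff_distrib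
        scaleC_diff_right mult_scaleC_left mult_scaleC_right scaleC_scaleC scaleC_one)
  have "scaleC (- 1) (adj a * b) = - (adj a * b)"
    using complex_space.scale_minus_left[of 1] by (simp add: scaleC_one)
  moreover have "scaleC 2 (adj a * b) = adj a * b + adj a * b"
    using scaleC_add_left[of 1 1 "adj a * b"] by (simp add: scaleC_one)
  ultimately show ?thesis unfolding 1 2
    by (simp add: scaleC_add_right scaleC_diff_right scaleC_scaleC scaleC_one)
qed

text \<open>The defect is a difference of two sesquilinear expressions, and each of them satisfies
  the polarization identity.\<close>

lemma polarization_defect:
  assumes \<psi>: "cpc_map A F \<psi>" and A: "cstar_algebra A" and ab: "a \<in> A" "b \<in> A"
  defines "D \<equiv> \<lambda>x. \<psi> (adj x * x) - adj (\<psi> x) * \<psi> x"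
  shows "scaleC 2 (\<psi> (adj a * b) - adj (\<psi> a) * \<psi> b)
    = (D (a + b) - D a - D b) - scaleC \<i> (D (a + scaleC \<i> b) - D a - D b)"
proof -
  note cl = cstar_algebra_closed[OF A]
  note lin = cpc_map_add[OF \<psi>] cpc_map_diff[OF \<psi> A] cpc_map_scaleC[OF \<psi>]
  have "scaleC 2 (\<psi> (adj a * b)) = \<psi> (scaleC 2 (adj a * b))"
    using ab by (simp add: lin cl)
  also have "\<dots> = (\<psi> (adj (a + b) * (a + b)) - \<psi> (adj a * a) - \<psi> (adj b * b))
      - scaleC \<i> (\<psi> (adj (a + scaleC \<i> b) * (a + scaleC \<i> b)) - \<psi> (adj a * a) - \<psi> (adj b * b))"
    unfolding polarization[of a b] using ab by (simp only: lin cl)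
  finally show ?thesis
    using ab polarization[of "\<psi> a" "\<psi> b"]
    by (simp add: D_def scaleC_diff_right lin cl)
qed

lemma bounded_linear_adj: "bounded_linear (adj :: 'a::pre_cstar_algebra \<Rightarrow> 'a)"
  by (rule bounded_linear_intro[of _ 1]) (simp_all add: adj_add adj_scaleR)

lemma norm_mult_diff_le:
  fixes x y u v :: "'b::real_normed_algebra"
  assumes "norm (x - u) \<le> \<delta>" "norm (y - v) \<le> \<delta>" "norm x \<le> C" "norm v \<le> C"
  shows "norm (x * y - u * v) \<le> 2 * C * \<delta>"
proof -
  have C: "0 \<le> C" "0 \<le> \<delta>" using assms(1,3) norm_ge_zero order_trans by blast+
  have "x * y - u * v = x * (y - v) + (x - u) * v" by (simp add: algebra_simps)
  also have "norm \<dots> \<le> C * \<delta> + \<delta> * C"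
    using assms C
    by (intro order_trans[OF norm_triangle_ineq] add_mono order_trans[OF norm_mult_ineq] mult_mono) auto
  finally show ?thesis by simp
qed

section \<open>Limits along the system and properties of the connecting maps\<close>

locale summable_cpc_system =
  fixes A :: "'a::pre_cstar_algebra set" and F :: "nat \<Rightarrow> 'f::pre_cstar_algebra set"
    and \<psi> :: "nat \<Rightarrow> 'a \<Rightarrow> 'f" and \<phi> :: "nat \<Rightarrow> 'f \<Rightarrow> 'a"
  assumes A: "cstar_algebra A" and nuclear: "nuclear A"
    and approximations: "cpc_approximations A F \<psi> \<phi>"
    and summable: "summable_approximations F \<psi> \<phi>"
begin

definition \<rho> :: "nat \<Rightarrow> nat \<Rightarrow> 'f \<Rightarrow> 'f" where
  "\<rho> = connecting (\<lambda>n. \<psi> (Suc n) \<circ> \<phi> n)"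

lemma \<rho>_self [simp]: "\<rho> n n x = x"
  by (cases n) (simp_all add: \<rho>_def)

lemma \<rho>_Suc [simp]: "n \<le> m \<Longrightarrow> \<rho> (Suc m) n x = \<psi> (Suc m) (\<phi> m (\<rho> m n x))"
  by (simp add: \<rho>_def)

lemma \<rho>_comp: "n \<le> m \<Longrightarrow> k \<le> n \<Longrightarrow> \<rho> m n (\<rho> n k x) = \<rho> m k x"
  by (induction m rule: dec_induct) simp_all

lemma F: "cstar_algebra (F n)" and \<psi>: "cpc_map A (F n) (\<psi> n)" and \<phi>: "cpc_map (F n) A (\<phi> n)"
  using approximations by (auto simp: cpc_approximations_def)

lemmas closed = cstar_algebra_closed[OF A] cstar_algebra_closed[OF F]
  cpc_map_closed[OF \<psi>] cpc_map_closed[OF \<phi>]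

lemma \<phi>_\<psi>_tendsto: "a \<in> A \<Longrightarrow> (\<lambda>n. \<phi> n (\<psi> n a)) \<longlonglongrightarrow> a"
  using approximations
  by (auto simp: cpc_approximations_def intro: LIM_zero_cancel tendsto_norm_zero_cancel)

text \<open>On squares the defect is dominated by a gap whose two terms both converge to
  \<open>adj x * x\<close>; polarization extends this to products.\<close>

lemma \<phi>_defect_tendsto:
  assumes ab: "a \<in> A" "b \<in> A"
  shows "(\<lambda>n. \<phi> n (\<psi> n (adj a * b) - adj (\<psi> n a) * \<psi> n b)) \<longlonglongrightarrow> 0"
proof -
  define D where "D n x = \<psi> n (adj x * x) - adj (\<psi> n x) * \<psi> n x" for n x
  have DF: "D n x \<in> F n" if "x \<in> A" for n x
    using that by (simp add: D_def closed)
  have D0: "(\<lambda>n. \<phi> n (D n x)) \<longlonglongrightarrow> 0" if x: "x \<in> A" for x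
  proof (rule tendsto_0_le[of _ _ _ 1])
    have "(\<lambda>n. \<phi> n (\<psi> n (adj x * x)) - adj (\<phi> n (\<psi> n x)) * \<phi> n (\<psi> n x)) \<longlonglongrightarrow> adj x * x - adj x * x"
      using x by (intro tendsto_intros bounded_linear.tendsto[OF bounded_linear_adj] \<phi>_\<psi>_tendsto)
        (simp_all add: closed)
    then show "(\<lambda>n. \<phi> n (\<psi> n (adj x * x)) - adj (\<phi> n (\<psi> n x)) * \<phi> n (\<psi> n x)) \<longlonglongrightarrow> 0" by simp
    show "\<forall>\<^sub>F n in sequentially. norm (\<phi> n (D n x))
        \<le> norm (\<phi> n (\<psi> n (adj x * x)) - adj (\<phi> n (\<psi> n x)) * \<phi> n (\<psi> n x)) * 1"
      using norm_Schwarz_defect_le[OF A nuclear F \<psi> \<phi> x] by (simp add: D_def)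
  qed
  let ?E = "\<lambda>n. \<psi> n (adj a * b) - adj (\<psi> n a) * \<psi> n b"
  let ?c = "a + scaleC \<i> b"
  have c: "?c \<in> A" "a + b \<in> A" using ab by (simp_all add: closed)
  have EF: "?E n \<in> F n" for n using ab by (simp add: closed)
  have eq: "scaleC 2 (\<phi> n (?E n))
    = (\<phi> n (D n (a + b)) - \<phi> n (D n a) - \<phi> n (D n b))
      - scaleC \<i> (\<phi> n (D n ?c) - \<phi> n (D n a) - \<phi> n (D n b))" for n
  proof -
    have "scaleC 2 (\<phi> n (?E n)) = \<phi> n (scaleC 2 (?E n))" by (simp add: cpc_map_scaleC[OF \<phi>] EF)
    also have "scaleC 2 (?E n) = (D n (a + b) - D n a - D n b) - scaleC \<i> (D n ?c - D n a - D n b)"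
      unfolding D_def by (rule polarization_defect[OF \<psi> A ab])
    finally show ?thesis
      using ab c by (simp add: cpc_map_diff[OF \<phi> F] cpc_map_scaleC[OF \<phi>] DF closed)
  qed
  have "bounded_linear (scaleC \<i> :: 'a \<Rightarrow> 'a)"
    by (rule bounded_linear_intro[of _ 1])
      (simp_all add: scaleC_add_right norm_scaleC scaleR_scaleC scaleC_scaleC mult.commute)
  note tendsto_scaleC = bounded_linear.tendsto[OF this]
  have "(\<lambda>n. scaleC 2 (\<phi> n (?E n))) \<longlonglongrightarrow> (0 - 0 - 0) - scaleC \<i> (0 - 0 - 0)"
    unfolding eq by (intro tendsto_diff tendsto_scaleC D0 ab c)
  then have "(\<lambda>n. scaleC 2 (\<phi> n (?E n))) \<longlonglongrightarrow> 0" by simp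
  then show ?thesis
    by (rule tendsto_0_le[where K = 1]) (simp add: norm_scaleC)
qed

lemma \<phi>_mult_tendsto:
  assumes ab: "a \<in> A" "b \<in> A"
  shows "(\<lambda>n. \<phi> n (\<psi> n a * \<psi> n b)) \<longlonglongrightarrow> a * b"
proof -
  have "(\<lambda>n. \<phi> n (\<psi> n (a * b)) - \<phi> n (\<psi> n (adj (adj a) * b) - adj (\<psi> n (adj a)) * \<psi> n b)) \<longlonglongrightarrow> a * b - 0"
    using ab by (intro tendsto_diff \<phi>_\<psi>_tendsto \<phi>_defect_tendsto) (simp_all add: closed)
  then show ?thesis
    using ab by (simp add: adj_adj cpc_map_adj[OF \<psi> A] cpc_map_diff[OF \<phi> F] closed)
qed

lemma \<rho>_closed: "n \<le> m \<Longrightarrow> x \<in> F n \<Longrightarrow> \<rho> m n x \<in> F m"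
  by (induction m rule: dec_induct) (simp_all add: closed)

lemma \<rho>_diff: "n \<le> m \<Longrightarrow> x \<in> F n \<Longrightarrow> y \<in> F n \<Longrightarrow> \<rho> m n (x - y) = \<rho> m n x - \<rho> m n y"
  by (induction m rule: dec_induct)
    (simp_all add: cpc_map_diff[OF \<phi> F] cpc_map_diff[OF \<psi> A] closed \<rho>_closed)

lemma norm_\<rho>_le: "n \<le> m \<Longrightarrow> x \<in> F n \<Longrightarrow> norm (\<rho> m n x) \<le> norm x"
proof (induction m rule: dec_induct)
  case (step m)
  then have "norm (\<rho> (Suc m) n x) \<le> norm (\<phi> m (\<rho> m n x))"
    by (simp add: cpc_map_norm[OF \<psi>] closed \<rho>_closed)
  also have "\<dots> \<le> norm (\<rho> m n x)"
    using step by (simp add: cpc_map_norm[OF \<phi>] \<rho>_closed)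
  finally show ?case using step by simp
qed simp

text \<open>The supremum in \<open>opnorm_on\<close> is informative only for a bounded set;
  contractivity supplies the bound 2, and scaling to the unit ball does the rest.\<close>

lemma norm_\<phi>_diff_le:
  assumes x: "x \<in> F n"
  shows "norm (\<phi> n x - \<phi> m (\<psi> m (\<phi> n x)))
    \<le> opnorm_on (F n) (\<lambda>x. \<phi> n x - \<phi> m (\<psi> m (\<phi> n x))) * norm x"
proof (cases "x = 0")
  case True
  have "\<phi> k 0 = 0" "\<psi> k 0 = 0" for k
    using cpc_map_norm[OF \<phi>, of 0 k] cpc_map_norm[OF \<psi>, of 0 k] by (simp_all add: closed)
  with True show ?thesis by simp
next
  case False
  define f where "f x = \<phi> n x - \<phi> m (\<psi> m (\<phi> n x))" for x
  have bound: "norm (f y) \<le> 2" if y: "y \<in> F n" "norm y \<le> 1" for y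
  proof -
    have 1: "norm (\<phi> n y) \<le> norm y" by (rule cpc_map_norm[OF \<phi> y(1)])
    have "norm (\<phi> m (\<psi> m (\<phi> n y))) \<le> norm (\<psi> m (\<phi> n y))"
      using y by (intro cpc_map_norm[OF \<phi>]) (simp add: closed)
    also have "\<dots> \<le> norm (\<phi> n y)" using y by (intro cpc_map_norm[OF \<psi>]) (simp add: closed)
    finally show ?thesis
      using 1 y(2) norm_triangle_ineq4[of "\<phi> n y" "\<phi> m (\<psi> m (\<phi> n y))"] by (simp add: f_def)
  qed
  define y where "y = inverse (norm x) *\<^sub>R x"
  have y: "y \<in> F n" "norm y \<le> 1" using False x by (simp_all add: y_def closed)
  have xy: "x = norm x *\<^sub>R y" using False by (simp add: y_def)
  have "f x = norm x *\<^sub>R f y"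
    by (subst xy) (simp add: f_def y closed cpc_map_scaleR[OF \<phi>] cpc_map_scaleR[OF \<psi>] scaleR_diff_right)
  moreover have "norm (f y) \<le> opnorm_on (F n) f"
    unfolding opnorm_on_def using y bound
    by (intro cSUP_upper bdd_aboveI2[where M = 2]) auto
  ultimately have "norm (f x) \<le> opnorm_on (F n) f * norm x"
    by (simp add: mult.commute mult_left_mono)
  then show ?thesis unfolding f_def .
qed

text \<open>\<phi>_m \<rho>_{m,n} - \<phi>_n telescopes into one-step errors, each bounded by a term
  of the summable series because the connecting maps are contractive. The tail is uniformly
  small.\<close>

lemma \<rho>_approx:
  assumes "\<delta> > 0"
  shows "\<exists>N. \<forall>n\<ge>N. \<forall>m>n. \<forall>x\<in>F n. norm (\<rho> m n x - \<psi> m (\<phi> n x)) \<le> \<delta> * norm x"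
proof -
  obtain \<epsilon> :: "nat \<Rightarrow> real" where \<epsilon>: "\<And>m. 0 \<le> \<epsilon> m" "summable \<epsilon>"
    and op: "\<And>n m. n < m \<Longrightarrow> opnorm_on (F n) (\<lambda>x. \<phi> n x - \<phi> m (\<psi> m (\<phi> n x))) < \<epsilon> m"
    using summable unfolding summable_approximations_def by blast
  have one_step: "norm (\<phi> m (\<psi> m (\<phi> n x)) - \<phi> n x) \<le> \<epsilon> m * norm x" if "n < m" "x \<in> F n" for n m x
    using norm_\<phi>_diff_le[OF that(2), of m] mult_right_mono[OF less_imp_le[OF op[OF that(1)]], of "norm x"]
    by (simp add: norm_minus_commute)
  have tele: "norm (\<phi> m (\<rho> m n x) - \<phi> n x) \<le> (\<Sum>j\<in>{n<..m}. \<epsilon> j) * norm x" if "n \<le> m" "x \<in> F n" for n m x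
    using that(1)
  proof (induction m rule: dec_induct)
    case (step m)
    have "norm (\<phi> (Suc m) (\<rho> (Suc m) n x) - \<phi> m (\<rho> m n x)) \<le> \<epsilon> (Suc m) * norm (\<rho> m n x)"
      using step.hyps that(2) one_step[of m "Suc m" "\<rho> m n x"] by (simp add: \<rho>_closed)
    also have "\<dots> \<le> \<epsilon> (Suc m) * norm x"
      using step.hyps that(2) by (intro mult_left_mono norm_\<rho>_le \<epsilon>)
    finally have "norm (\<phi> (Suc m) (\<rho> (Suc m) n x) - \<phi> n x) \<le> \<epsilon> (Suc m) * norm x + (\<Sum>j\<in>{n<..m}. \<epsilon> j) * norm x"
      using step.IH norm_triangle_ineq[of "\<phi> (Suc m) (\<rho> (Suc m) n x) - \<phi> m (\<rho> m n x)" "\<phi> m (\<rho> m n x) - \<phi> n x"]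
      by simp
    moreover have "{n<..Suc m} = insert (Suc m) {n<..m}" using step.hyps by auto
    ultimately show ?case by (simp add: distrib_right)
  qed simp
  obtain N where N: "\<And>m n. m \<ge> N \<Longrightarrow> norm (sum \<epsilon> {m..<n}) < \<delta>"
    using \<epsilon>(2) assms unfolding summable_Cauchy by blast
  have "norm (\<rho> m n x - \<psi> m (\<phi> n x)) \<le> \<delta> * norm x" if n: "n \<ge> N" "m > n" and x: "x \<in> F n" for n m x
  proof -
    \<comment> \<open>The telescoping stops at m - 1: both maps to be compared end with the
      contraction \<psi>_m.\<close>
    obtain l where l: "m = Suc l" "n \<le> l" using n by (cases m) auto
    have "\<rho> m n x - \<psi> m (\<phi> n x) = \<psi> m (\<phi> l (\<rho> l n x) - \<phi> n x)"
      using l x by (simp add: cpc_map_diff[OF \<psi> A] closed \<rho>_closed)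
    also have "norm \<dots> \<le> norm (\<phi> l (\<rho> l n x) - \<phi> n x)"
      using l x by (intro cpc_map_norm[OF \<psi>]) (simp add: closed \<rho>_closed)
    also have "\<dots> \<le> (\<Sum>j\<in>{n<..l}. \<epsilon> j) * norm x" by (rule tele[OF l(2) x])
    also have "(\<Sum>j\<in>{n<..l}. \<epsilon> j) = (\<Sum>j\<in>{Suc n..<Suc l}. \<epsilon> j)"
      by (rule sum.cong) auto
    also have "\<dots> * norm x \<le> \<delta> * norm x"
      using N[of "Suc n" "Suc l"] n by (intro mult_right_mono) auto
    finally show ?thesis .
  qed
  then show ?thesis by blast
qed

text \<open>Pushing \<open>x\<close> and \<open>y\<close> into \<open>A\<close> at a late stage
  \<open>j\<close> gives \<open>a\<close> and \<open>b\<close> with \<rho>_{n,k} x near \<psi>_n a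
  and \<rho>_{n,k} y near \<psi>_n b. The product is then near \<psi>_n (ab), which \<rho>_{m,n}
  sends near \<psi>_m (ab).\<close>

lemma approximately_multiplicative_imp:
  assumes am: "approximately_multiplicative A \<psi>"
  shows "asymptotically_multiplicative F (\<lambda>n. \<psi> (Suc n) \<circ> \<phi> n)"
  unfolding asymptotically_multiplicative_def \<rho>_def[symmetric]
proof (intro allI ballI impI)
  fix k x y and \<epsilon> :: real
  assume x: "x \<in> F k" and y: "y \<in> F k" and \<epsilon>: "\<epsilon> > 0"
  define C where "C = norm x + norm y + 1"
  have C: "C \<ge> 1" "norm x \<le> C" "norm y \<le> C" by (simp_all add: C_def)
  \<comment> \<open>The four final errors are at most 3, 1, 1 and 3 times
    \<open>\<delta> * (C * C)\<close>, the third strictly; \<open>C \<ge> 1\<close> absorbs a bare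
    \<delta>.\<close>
  define \<delta> where "\<delta> = \<epsilon> / (8 * C * C)"
  have \<delta>: "\<delta> > 0" using \<epsilon> C by (simp add: \<delta>_def)
  obtain N where N: "\<And>n m x. n \<ge> N \<Longrightarrow> m > n \<Longrightarrow> x \<in> F n \<Longrightarrow> norm (\<rho> m n x - \<psi> m (\<phi> n x)) \<le> \<delta> * norm x"
    using \<rho>_approx[OF \<delta>] by blast
  \<comment> \<open>\<open>N\<close> serves \<open>\<rho>_approx\<close>; \<open>Suc k\<close>
    provides the strict inequality \<open>M > k\<close>.\<close>
  define j where "j = max N (Suc k)"
  have j: "k \<le> j" "j \<ge> N" by (simp_all add: j_def)
  define a where "a = \<phi> j (\<rho> j k x)"
  define b where "b = \<phi> j (\<rho> j k y)"
  have ab: "a \<in> A" "b \<in> A" using j x y by (simp_all add: a_def b_def closed \<rho>_closed)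
  have nab: "norm a \<le> C" "norm b \<le> C"
    using cpc_map_norm[OF \<phi> \<rho>_closed[OF j(1) x]] norm_\<rho>_le[OF j(1) x]
      cpc_map_norm[OF \<phi> \<rho>_closed[OF j(1) y]] norm_\<rho>_le[OF j(1) y] C
    by (auto simp: a_def b_def)
  have near: "norm (\<rho> n k z - \<psi> n (\<phi> j (\<rho> j k z))) \<le> \<delta> * C" if "n > j" "z \<in> F k" "norm z \<le> C" for n z
  proof -
    have "norm (\<rho> n j (\<rho> j k z) - \<psi> n (\<phi> j (\<rho> j k z))) \<le> \<delta> * norm (\<rho> j k z)"
      using that j by (intro N) (simp_all add: \<rho>_closed)
    also have "\<dots> \<le> \<delta> * C"
      using norm_\<rho>_le[OF j(1) that(2)] that(3) \<delta> by (intro mult_left_mono) auto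
    finally show ?thesis using \<rho>_comp[of j n k] that j by simp
  qed
  have "(\<lambda>n. norm (\<psi> n (a * b) - \<psi> n a * \<psi> n b)) \<longlonglongrightarrow> 0"
    using am ab by (simp add: approximately_multiplicative_def)
  then have "\<forall>\<^sub>F n in sequentially. norm (\<psi> n (a * b) - \<psi> n a * \<psi> n b) < \<delta>"
    using \<delta> by (rule order_tendstoD)
  moreover have "\<forall>\<^sub>F n in sequentially. dist (\<phi> n (\<psi> n (a * b))) (a * b) < \<delta>"
    using ab \<delta> by (intro tendstoD[OF \<phi>_\<psi>_tendsto]) (simp_all add: closed)
  ultimately obtain M0 where M0: "\<And>n. n \<ge> M0 \<Longrightarrow> norm (\<psi> n (a * b) - \<psi> n a * \<psi> n b) < \<delta>"
    "\<And>n. n \<ge> M0 \<Longrightarrow> norm (\<phi> n (\<psi> n (a * b)) - a * b) < \<delta>"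
    unfolding eventually_sequentially dist_norm by (metis nle_le order_trans)
  define M where "M = max M0 j"
  have prod: "norm (\<rho> n k x * \<rho> n k y - \<psi> n (a * b)) \<le> 3 * \<delta> * C * C" if n: "n > M" for n
  proof -
    have "n > j" "n \<ge> k" using n j by (auto simp: M_def)
    then have "norm (\<rho> n k x * \<rho> n k y - \<psi> n a * \<psi> n b) \<le> 2 * C * (\<delta> * C)"
      using near[of n x] near[of n y] x y C nab norm_\<rho>_le[OF _ x, of n] cpc_map_norm[OF \<psi> ab(2), of n]
      by (intro norm_mult_diff_le) (auto simp: a_def b_def)
    moreover have "norm (\<psi> n (a * b) - \<psi> n a * \<psi> n b) < \<delta>" using n by (intro M0) (simp add: M_def)
    moreover have "\<delta> \<le> \<delta> * (C * C)"
      using \<delta> C mult_mono[of 1 C 1 C] by simp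
    moreover have "norm (\<rho> n k x * \<rho> n k y - \<psi> n (a * b))
        \<le> norm (\<rho> n k x * \<rho> n k y - \<psi> n a * \<psi> n b) + norm (\<psi> n (a * b) - \<psi> n a * \<psi> n b)"
      using norm_triangle_ineq4[of "\<rho> n k x * \<rho> n k y - \<psi> n a * \<psi> n b" "\<psi> n (a * b) - \<psi> n a * \<psi> n b"]
      by simp
    ultimately show ?thesis by (simp add: mult_ac)
  qed
  show "\<exists>M>k. \<forall>n>M. \<forall>m>n. norm (\<rho> m n (\<rho> n k x * \<rho> n k y) - \<rho> m k x * \<rho> m k y) < \<epsilon>"
  proof (intro exI[of _ M] conjI allI impI)
    show "M > k" by (auto simp: M_def j_def)
    fix n m assume n: "n > M" and m: "m > n"
    have nk: "k \<le> n" "n \<ge> N" "n \<ge> M0" using n j by (auto simp: M_def)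
    let ?p = "\<rho> n k x * \<rho> n k y" and ?c = "\<psi> n (a * b)"
    have pF: "?p \<in> F n" and cF: "?c \<in> F n" and abA: "a * b \<in> A"
      using nk x y ab by (simp_all add: closed \<rho>_closed)
    have 1: "norm (\<rho> m n ?p - \<rho> m n ?c) \<le> 3 * \<delta> * C * C"
      using norm_\<rho>_le[of n m "?p - ?c"] prod[OF n] m pF cF by (simp add: \<rho>_diff closed)
    have "norm ?c \<le> norm a * norm b"
      using cpc_map_norm[OF \<psi> abA, of n] norm_mult_ineq[of a b] by simp
    also have "\<dots> \<le> C * C" using nab C(1) by (intro mult_mono) auto
    finally have "\<delta> * norm ?c \<le> \<delta> * (C * C)" using \<delta> by simp
    with N[OF nk(2) m cF] have 2: "norm (\<rho> m n ?c - \<psi> m (\<phi> n ?c)) \<le> \<delta> * (C * C)" by simp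
    have "norm (\<psi> m (\<phi> n ?c) - \<psi> m (a * b)) \<le> norm (\<phi> n ?c - a * b)"
      using cpc_map_norm[OF \<psi>, of "\<phi> n ?c - a * b" m] cF abA
      by (simp add: cpc_map_diff[OF \<psi> A] closed)
    then have 3: "norm (\<psi> m (\<phi> n ?c) - \<psi> m (a * b)) < \<delta>" using M0(2)[OF nk(3)] by simp
    have 4: "norm (\<psi> m (a * b) - \<rho> m k x * \<rho> m k y) \<le> 3 * \<delta> * C * C"
      using prod[of m] n m by (simp add: norm_minus_commute)
    have "\<delta> \<le> \<delta> * (C * C)" using \<delta> C mult_mono[of 1 C 1 C] by simp
    moreover have "\<delta> * (C * C) * 8 = \<epsilon>" using C by (simp add: \<delta>_def)
    moreover have "norm (\<rho> m n ?p - \<rho> m k x * \<rho> m k y)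
      \<le> norm (\<rho> m n ?p - \<rho> m n ?c) + norm (\<rho> m n ?c - \<psi> m (\<phi> n ?c))
        + norm (\<psi> m (\<phi> n ?c) - \<psi> m (a * b)) + norm (\<psi> m (a * b) - \<rho> m k x * \<rho> m k y)"
      by norm
    ultimately show "norm (\<rho> m n ?p - \<rho> m k x * \<rho> m k y) < \<epsilon>" using 1 2 3 4 by (simp add: mult_ac)
  qed
qed

text \<open>Here \<open>\<phi>_mult_tendsto\<close> enters: \<psi>_m (ab) is near \<psi>_m \<phi>_n
  (\<psi>_n a \<psi>_n b), hence near \<rho>_{m,n} (\<psi>_n a \<psi>_n b). With \<psi>_n a and
  \<psi>_n b replaced by images of \<psi>_j a and \<psi>_j b, the hypothesis leads to \<psi>_m a
  \<psi>_m b.\<close>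

lemma asymptotically_multiplicative_imp:
  assumes am: "asymptotically_multiplicative F (\<lambda>n. \<psi> (Suc n) \<circ> \<phi> n)"
  shows "approximately_multiplicative A \<psi>"
  unfolding approximately_multiplicative_def
proof (intro ballI LIMSEQ_I)
  fix a b and \<epsilon> :: real
  assume ab: "a \<in> A" "b \<in> A" and \<epsilon>: "\<epsilon> > 0"
  define C where "C = norm a + norm b + 1"
  have C: "C \<ge> 1" "norm a \<le> C" "norm b \<le> C" by (simp_all add: C_def)
  \<comment> \<open>The five final errors add up to at most
    \<open>11 * (\<delta> * (C * C))\<close>, so 16 leaves room.\<close>
  define \<delta> where "\<delta> = \<epsilon> / (16 * C * C)"
  have \<delta>: "\<delta> > 0" using \<epsilon> C by (simp add: \<delta>_def)
  obtain N where N: "\<And>n m x. n \<ge> N \<Longrightarrow> m > n \<Longrightarrow> x \<in> F n \<Longrightarrow> norm (\<rho> m n x - \<psi> m (\<phi> n x)) \<le> \<delta> * norm x"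
    using \<rho>_approx[OF \<delta>] by blast
  have "\<forall>\<^sub>F n in sequentially. dist (\<phi> n (\<psi> n a)) a < \<delta>"
    "\<forall>\<^sub>F n in sequentially. dist (\<phi> n (\<psi> n b)) b < \<delta>"
    "\<forall>\<^sub>F n in sequentially. dist (\<phi> n (\<psi> n a * \<psi> n b)) (a * b) < \<delta>"
    using ab \<delta> by (auto intro!: tendstoD \<phi>_\<psi>_tendsto \<phi>_mult_tendsto)
  then have "\<forall>\<^sub>F n in sequentially. n \<ge> N \<and> norm (\<phi> n (\<psi> n a) - a) < \<delta> \<and> norm (\<phi> n (\<psi> n b) - b) < \<delta>
      \<and> norm (\<phi> n (\<psi> n a * \<psi> n b) - a * b) < \<delta>"
    using eventually_ge_at_top[of N] by (simp add: dist_norm eventually_conj_iff)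
  then obtain j where j: "\<And>n. n \<ge> j \<Longrightarrow> n \<ge> N \<and> norm (\<phi> n (\<psi> n a) - a) < \<delta> \<and> norm (\<phi> n (\<psi> n b) - b) < \<delta>
      \<and> norm (\<phi> n (\<psi> n a * \<psi> n b) - a * b) < \<delta>"
    unfolding eventually_sequentially by blast
  define x where "x = \<psi> j a"
  define y where "y = \<psi> j b"
  have xy: "x \<in> F j" "y \<in> F j" using ab by (simp_all add: x_def y_def closed)
  have near: "norm (\<rho> n j (\<psi> j c) - \<psi> n c) \<le> 2 * \<delta> * C"
    if n: "n > j" and c: "c \<in> A" "norm c \<le> C" "norm (\<phi> j (\<psi> j c) - c) < \<delta>" for n c
  proof -
    have "norm (\<rho> n j (\<psi> j c) - \<psi> n (\<phi> j (\<psi> j c))) \<le> \<delta> * norm (\<psi> j c)"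
      using j[of j] n c by (intro N) (simp_all add: closed)
    also have "\<dots> \<le> \<delta> * C"
      using cpc_map_norm[OF \<psi> c(1), of j] c(2) \<delta> by (intro mult_left_mono) auto
    finally have 1: "norm (\<rho> n j (\<psi> j c) - \<psi> n (\<phi> j (\<psi> j c))) \<le> \<delta> * C" .
    have "norm (\<psi> n (\<phi> j (\<psi> j c)) - \<psi> n c) \<le> norm (\<phi> j (\<psi> j c) - c)"
      using cpc_map_norm[OF \<psi>, of "\<phi> j (\<psi> j c) - c" n] c by (simp add: cpc_map_diff[OF \<psi> A] closed)
    also have "\<dots> \<le> \<delta> * C" using c(3) mult_left_mono[OF C(1) less_imp_le[OF \<delta>]] by linarith
    finally show ?thesis using 1
      norm_triangle_ineq[of "\<rho> n j (\<psi> j c) - \<psi> n (\<phi> j (\<psi> j c))" "\<psi> n (\<phi> j (\<psi> j c)) - \<psi> n c"]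
      by simp
  qed
  have prod: "norm (\<rho> n j x * \<rho> n j y - \<psi> n a * \<psi> n b) \<le> 4 * (\<delta> * (C * C))" if n: "n > j" for n
  proof -
    have "norm (\<rho> n j x) \<le> C"
      using norm_\<rho>_le[of j n x] n xy cpc_map_norm[OF \<psi> ab(1), of j] C by (simp add: x_def)
    then have "norm (\<rho> n j x * \<rho> n j y - \<psi> n a * \<psi> n b) \<le> 2 * C * (2 * \<delta> * C)"
      using near[OF n ab(1)] near[OF n ab(2)] C j[of j] cpc_map_norm[OF \<psi> ab(2), of n]
      by (intro norm_mult_diff_le) (auto simp: x_def y_def)
    then show ?thesis by (simp add: mult_ac)
  qed
  obtain M where M: "M > j"
    "\<And>n m. n > M \<Longrightarrow> m > n \<Longrightarrow> norm (\<rho> m n (\<rho> n j x * \<rho> n j y) - \<rho> m j x * \<rho> m j y) < \<delta>"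
    using am xy \<delta> unfolding asymptotically_multiplicative_def \<rho>_def[symmetric] by blast
  \<comment> \<open>A single intermediate index suffices; only \<open>m\<close> varies from here
    on.\<close>
  define n where "n = Suc M"
  have n: "n > j" "n > M" "n \<ge> N" "norm (\<phi> n (\<psi> n a * \<psi> n b) - a * b) < \<delta>"
    using M(1) j[of n] by (auto simp: n_def)
  have "norm (\<psi> m (a * b) - \<psi> m a * \<psi> m b) < \<epsilon>" if m: "m > n" for m
  proof -
    let ?p = "\<rho> n j x * \<rho> n j y" and ?c = "\<psi> n a * \<psi> n b"
    have pF: "?p \<in> F n" and cF: "?c \<in> F n" and abA: "a * b \<in> A"
      using n xy ab by (simp_all add: closed \<rho>_closed)
    have "norm (\<psi> m (\<phi> n ?c) - \<psi> m (a * b)) \<le> norm (\<phi> n ?c - a * b)"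
      using cpc_map_norm[OF \<psi>, of "\<phi> n ?c - a * b" m] cF abA
      by (simp add: cpc_map_diff[OF \<psi> A] closed)
    then have 1: "norm (\<psi> m (a * b) - \<psi> m (\<phi> n ?c)) < \<delta>" using n by (simp add: norm_minus_commute)
    have "norm ?c \<le> norm (\<psi> n a) * norm (\<psi> n b)" by (rule norm_mult_ineq)
    also have "\<dots> \<le> C * C"
      using cpc_map_norm[OF \<psi> ab(1), of n] cpc_map_norm[OF \<psi> ab(2), of n] C by (intro mult_mono) auto
    finally have "\<delta> * norm ?c \<le> \<delta> * (C * C)" using \<delta> by simp
    with N[OF n(3) m cF] have 2: "norm (\<psi> m (\<phi> n ?c) - \<rho> m n ?c) \<le> \<delta> * (C * C)"
      by (simp add: norm_minus_commute)
    have 3: "norm (\<rho> m n ?c - \<rho> m n ?p) \<le> 4 * (\<delta> * (C * C))"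
      using norm_\<rho>_le[of n m "?p - ?c"] prod[OF n(1)] m pF cF
      by (simp add: \<rho>_diff closed norm_minus_commute)
    have 4: "norm (\<rho> m n ?p - \<rho> m j x * \<rho> m j y) < \<delta>" by (rule M(2)[OF n(2) m])
    have 5: "norm (\<rho> m j x * \<rho> m j y - \<psi> m a * \<psi> m b) \<le> 4 * (\<delta> * (C * C))"
      using m n by (intro prod) simp
    have "\<delta> \<le> \<delta> * (C * C)" using \<delta> C mult_mono[of 1 C 1 C] by simp
    moreover have "\<delta> * (C * C) * 16 = \<epsilon>" using C by (simp add: \<delta>_def)
    moreover have "norm (\<psi> m (a * b) - \<psi> m a * \<psi> m b)
      \<le> norm (\<psi> m (a * b) - \<psi> m (\<phi> n ?c)) + norm (\<psi> m (\<phi> n ?c) - \<rho> m n ?c)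
        + norm (\<rho> m n ?c - \<rho> m n ?p) + norm (\<rho> m n ?p - \<rho> m j x * \<rho> m j y)
        + norm (\<rho> m j x * \<rho> m j y - \<psi> m a * \<psi> m b)"
      by norm
    ultimately show ?thesis using 1 2 3 4 5 \<delta> by linarith
  qed
  then show "\<exists>M. \<forall>m\<ge>M. norm (norm (\<psi> m (a * b) - \<psi> m a * \<psi> m b) - 0) < \<epsilon>"
    by (intro exI[of _ "Suc n"]) auto
qed

end

theorem proposition5p1:
  fixes A :: "'a::pre_cstar_algebra set"
    and F :: "nat \<Rightarrow> 'f::pre_cstar_algebra set"
    and \<psi> :: "nat \<Rightarrow> 'a \<Rightarrow> 'f"
    and \<phi> :: "nat \<Rightarrow> 'f \<Rightarrow> 'a"
  assumes "cstar_algebra A" and "separable A" and "nuclear A"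
    and "cpc_approximations A F \<psi> \<phi>"
    and "summable_approximations F \<psi> \<phi>"
  shows "asymptotically_multiplicative F (\<lambda>n. \<psi> (Suc n) \<circ> \<phi> n) \<longleftrightarrow>
         approximately_multiplicative A \<psi>"
proof -
  interpret summable_cpc_system A F \<psi> \<phi>
    using assms by unfold_locales
  show ?thesis
    using approximately_multiplicative_imp asymptotically_multiplicative_imp by blast
qed

end
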